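(* Let $\mu=\sum_{i=1}^6a_i\delta_{\lambda_i}$ be a probability measure with exactly $6$ atoms, where $a_i>0$ and $0<\lambda_1<\lambda_2<\cdots<\lambda_6$, such that $\lambda_2^2=\lambda_1\lambda_3$ and $\lambda_5^2=\lambda_4\lambda_6$. Then the Aluthge transform $\tilde W_\mu$ of the weighted shift $W_\mu$ is not subnormal.
   Context: $\delta_x$ is the Dirac measure at $x$. Given a compactly supported probability measure $\mu$ on $(0,\infty)$, let $\gamma_n=\int t^n\,d\mu(t)$ and $\alpha_n=\sqrt{\gamma_{n+1}/\gamma_n}$, $n\ge 0$. The weighted shift $W_\mu$ is the operator on $\ell^2(\mathbb{Z}_+)$ with orthonormal basis $(e_n)_{n\ge0}$ given by $W_\mu e_n=\alpha_n e_{n+1}$ (it is subnormal with Berger measure $\mu$). The Aluthge transform of an operator $T$ with polar decomposition $T=U|T|$ is $\tilde T=|T|^{1/2}U|T|^{1/2}$; for $W_\mu$ it is the weighted shift $\tilde W_\mu e_n=\sqrt{\alpha_n\alpha_{n+1}}\,e_{n+1}$. An operator is subnormal if it is the restriction of a normal operator to an invariant subspace. *)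

theory Defs
  imports "HOL-Probability.Probability"
begin

section \<open>Complex Hilbert spaces\<close>

text \<open>
  A complex inner product space is presented as a real inner product space carrying a compatible
  complex structure, so that norm, metric and topology are those of the class real_inner. The
  complex inner product is linear in its first argument; the real one is its real part, hence
  both induce the same norm. Positivity and definiteness are inherited from real_inner.
\<close>

class complex_inner = real_inner +
  fixes scaleC :: "complex \<Rightarrow> 'a \<Rightarrow> 'a" (infixr "*\<^sub>C" 75)
    and cinner :: "'a \<Rightarrow> 'a \<Rightarrow> complex"
  assumes scaleC_of_real: "complex_of_real r *\<^sub>C x = r *\<^sub>R x"
    and scaleC_add_right: "c *\<^sub>C (x + y) = c *\<^sub>C x + c *\<^sub>C y"
    and scaleC_add_left: "(c + d) *\<^sub>C x = c *\<^sub>C x + d *\<^sub>C x"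
    and scaleC_scaleC: "c *\<^sub>C d *\<^sub>C x = (c * d) *\<^sub>C x"
    and cinner_commute: "cinner x y = cnj (cinner y x)"
    and cinner_add_left: "cinner (x + y) z = cinner x z + cinner y z"
    and cinner_scaleC_left: "cinner (c *\<^sub>C x) y = c * cinner x y"
    and Re_cinner: "Re (cinner x y) = inner x y"

class chilbert_space = complex_inner + complete_space


section \<open>Bounded operators\<close>

definition bounded_clinear :: "('a::complex_inner \<Rightarrow> 'b::complex_inner) \<Rightarrow> bool" where
  "bounded_clinear T \<longleftrightarrow> bounded_linear T \<and> (\<forall>c x. T (c *\<^sub>C x) = c *\<^sub>C T x)"

definition is_adjoint :: "('a::complex_inner \<Rightarrow> 'a) \<Rightarrow> ('a \<Rightarrow> 'a) \<Rightarrow> bool" where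
  "is_adjoint T S \<longleftrightarrow> (\<forall>x y. cinner (T x) y = cinner x (S y))"

text \<open>
  The definite descriptions below denote the usual objects when applied to bounded operators on
  a Hilbert space: the adjoint, the unique positive square root of a positive operator, and the
  unique partial isometric factor of the polar decomposition.
\<close>

definition adj :: "('a::chilbert_space \<Rightarrow> 'a) \<Rightarrow> 'a \<Rightarrow> 'a" where
  "adj T = (THE S. is_adjoint T S)"

definition positive_op :: "('a::chilbert_space \<Rightarrow> 'a) \<Rightarrow> bool" where
  "positive_op P \<longleftrightarrow>
     bounded_clinear P \<and> (\<forall>x. cinner (P x) x \<in> \<real> \<and> 0 \<le> Re (cinner (P x) x))"

definition op_sqrt :: "('a::chilbert_space \<Rightarrow> 'a) \<Rightarrow> 'a \<Rightarrow> 'a" where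
  "op_sqrt A = (THE B. positive_op B \<and> B \<circ> B = A)"

definition op_abs :: "('a::chilbert_space \<Rightarrow> 'a) \<Rightarrow> 'a \<Rightarrow> 'a" where
  "op_abs T = op_sqrt (adj T \<circ> T)"

text \<open>A partial isometry is isometric on the orthogonal complement of its kernel.\<close>

definition partial_isometry :: "('a::chilbert_space \<Rightarrow> 'a) \<Rightarrow> bool" where
  "partial_isometry U \<longleftrightarrow>
     bounded_clinear U \<and> (\<forall>x. (\<forall>y. U y = 0 \<longrightarrow> cinner x y = 0) \<longrightarrow> norm (U x) = norm x)"

definition polar_factor :: "('a::chilbert_space \<Rightarrow> 'a) \<Rightarrow> 'a \<Rightarrow> 'a" where
  "polar_factor T =
     (THE U. partial_isometry U \<and> {x. U x = 0} = {x. T x = 0} \<and> T = U \<circ> op_abs T)"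

definition aluthge :: "('a::chilbert_space \<Rightarrow> 'a) \<Rightarrow> 'a \<Rightarrow> 'a" where
  "aluthge T = op_sqrt (op_abs T) \<circ> polar_factor T \<circ> op_sqrt (op_abs T)"

text \<open>
  Normality asks that the adjoint commute with the operator; adjoints are unique when they exist,
  and on a Hilbert space every bounded operator has one.
\<close>

definition normal_op :: "('a::chilbert_space \<Rightarrow> 'a) \<Rightarrow> bool" where
  "normal_op N \<longleftrightarrow> bounded_clinear N \<and> (\<exists>M. is_adjoint N M \<and> M \<circ> N = N \<circ> M)"

definition isometric_embedding :: "('a::complex_inner \<Rightarrow> 'b::complex_inner) \<Rightarrow> bool" where
  "isometric_embedding V \<longleftrightarrow>
     bounded_clinear V \<and> (\<forall>x y. cinner (V x) (V y) = cinner x y)"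

text \<open>
  An operator on the Hilbert space 'h is subnormal with an extension on the Hilbert space 'k if,
  after an isometric identification of 'h with a closed subspace of 'k, it is the restriction of
  a normal operator to that (then invariant) subspace. HOL cannot quantify over types inside a
  formula, so the space of the extension is a parameter. An operator fails to be subnormal iff
  it has no normal extension on any Hilbert space, i.e. iff the negation of the predicate
  holds for a type variable 'k.
\<close>

definition subnormal_on :: "'k::chilbert_space itself \<Rightarrow> ('h::chilbert_space \<Rightarrow> 'h) \<Rightarrow> bool" where
  "subnormal_on TYPE('k) T \<longleftrightarrow>
     (\<exists>(V :: 'h \<Rightarrow> 'k) (N :: 'k \<Rightarrow> 'k).
        isometric_embedding V \<and> normal_op N \<and> (\<forall>x. N (V x) = V (T x)))"


section \<open>The Hilbert space of square summable sequences\<close>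

typedef ell2 = "{f :: nat \<Rightarrow> complex. summable (\<lambda>n. (cmod (f n))\<^sup>2)}"
  morphisms seq Abs_ell2
  by (intro exI[of _ "\<lambda>_. 0"]) simp

lemma seq_summable: "summable (\<lambda>n. (cmod (seq x n))\<^sup>2)"
  using seq[of x] by simp

lemma seq_Abs: "summable (\<lambda>n. (cmod (f n))\<^sup>2) \<Longrightarrow> seq (Abs_ell2 f) = f"
  by (simp add: Abs_ell2_inverse)

lemma ell2_eqI: "(\<And>n. seq x n = seq y n) \<Longrightarrow> x = y"
  by (metis ext seq_inject)

lemma cmod_add_sq_le: "(cmod (a + b))\<^sup>2 \<le> 2 * (cmod a)\<^sup>2 + 2 * (cmod b)\<^sup>2"
proof -
  have "(cmod (a + b))\<^sup>2 \<le> (cmod a + cmod b)\<^sup>2"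
    by (intro power_mono norm_triangle_ineq) auto
  also have "\<dots> \<le> 2 * (cmod a)\<^sup>2 + 2 * (cmod b)\<^sup>2"
    using zero_le_power2[of "cmod a - cmod b"]
    unfolding power2_sum power2_diff by linarith
  finally show ?thesis .
qed

lemma sq_summable_add:
  assumes "summable (\<lambda>n. (cmod (f n))\<^sup>2)" "summable (\<lambda>n. (cmod (g n))\<^sup>2)"
  shows "summable (\<lambda>n. (cmod (f n + g n))\<^sup>2)"
  by (rule summable_comparison_test'[OF summable_add[OF summable_mult[OF assms(1), of 2]
        summable_mult[OF assms(2), of 2]], of 0]) (simp add: cmod_add_sq_le)

lemma sq_summable_scale:
  assumes "summable (\<lambda>n. (cmod (f n))\<^sup>2)"
  shows "summable (\<lambda>n. (cmod (c * f n))\<^sup>2)"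
  using summable_mult[OF assms, of "(cmod c)\<^sup>2"] by (simp add: norm_mult power_mult_distrib)

lemma summable_mult_cnj: "summable (\<lambda>n. seq x n * cnj (seq y n))"
proof (rule summable_comparison_test'[OF summable_add[OF seq_summable[of x] seq_summable[of y]]])
  fix n
  show "norm (seq x n * cnj (seq y n)) \<le> (cmod (seq x n))\<^sup>2 + (cmod (seq y n))\<^sup>2"
    using sum_squares_bound[of "cmod (seq x n)" "cmod (seq y n)"]
      mult_nonneg_nonneg[OF norm_ge_zero[of "seq x n"] norm_ge_zero[of "seq y n"]]
    unfolding norm_mult complex_mod_cnj by linarith
qed

instantiation ell2 :: complex_inner
begin

definition zero_ell2_def: "0 = Abs_ell2 (\<lambda>_. 0)"
definition plus_ell2_def: "x + y = Abs_ell2 (\<lambda>n. seq x n + seq y n)"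
definition uminus_ell2_def: "- x = Abs_ell2 (\<lambda>n. - seq x n)"
definition minus_ell2_def: "x - y = Abs_ell2 (\<lambda>n. seq x n - seq y n)"
definition scaleR_ell2_def: "r *\<^sub>R x = Abs_ell2 (\<lambda>n. complex_of_real r * seq x n)"
definition scaleC_ell2_def: "c *\<^sub>C x = Abs_ell2 (\<lambda>n. c * seq x n)"
definition cinner_ell2_def: "cinner x y = (\<Sum>n. seq x n * cnj (seq y n))"
definition inner_ell2_def: "inner x y = Re (\<Sum>n. seq x n * cnj (seq y n))" for x y :: ell2
definition norm_ell2_def: "norm x = sqrt (inner x x)" for x :: ell2
definition sgn_ell2_def: "sgn x = inverse (norm x) *\<^sub>R x" for x :: ell2
definition dist_ell2_def: "dist x y = norm (x - y)" for x y :: ell2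
definition uniformity_ell2_def:
  "(uniformity :: (ell2 \<times> ell2) filter) = (INF e\<in>{0 <..}. principal {(x, y). dist x y < e})"
definition open_ell2_def:
  "open (U :: ell2 set) \<longleftrightarrow> (\<forall>x\<in>U. \<forall>\<^sub>F (x', y) in uniformity. x' = x \<longrightarrow> y \<in> U)"

lemma seq_zero: "seq 0 n = 0"
  by (simp add: zero_ell2_def seq_Abs)

lemma seq_plus: "seq (x + y) n = seq x n + seq y n"
  by (simp add: plus_ell2_def seq_Abs sq_summable_add seq_summable)

lemma seq_uminus: "seq (- x) n = - seq x n"
  by (simp add: uminus_ell2_def seq_Abs seq_summable)

lemma seq_minus: "seq (x - y) n = seq x n - seq y n"
  using sq_summable_add[OF seq_summable[of x] seq_summable[of "- y"]]
  by (simp add: minus_ell2_def seq_Abs seq_uminus)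

lemma seq_scaleR: "seq (r *\<^sub>R x) n = complex_of_real r * seq x n"
  unfolding scaleR_ell2_def by (subst seq_Abs) (simp_all only: sq_summable_scale seq_summable)

lemma seq_scaleC: "seq (c *\<^sub>C x) n = c * seq x n"
  unfolding scaleC_ell2_def by (subst seq_Abs) (simp_all only: sq_summable_scale seq_summable)

lemma inner_self_ell2: "inner x x = (\<Sum>n. (cmod (seq x n))\<^sup>2)" for x :: ell2
proof -
  have "inner x x = Re (\<Sum>n. complex_of_real ((cmod (seq x n))\<^sup>2))"
    unfolding inner_ell2_def complex_norm_square ..
  also have "\<dots> = (\<Sum>n. (cmod (seq x n))\<^sup>2)"
    by (subst suminf_of_real[symmetric, OF seq_summable]) simp
  finally show ?thesis .
qed

instance
proof
  fix x y z :: ell2 and r s :: real and c d :: complex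
  show "x + y + z = x + (y + z)" "x + y = y + x" "0 + x = x" "- x + x = 0" "x - y = x + - y"
    by (rule ell2_eqI; simp add: seq_plus seq_uminus seq_minus seq_zero)+
  show "r *\<^sub>R (x + y) = r *\<^sub>R x + r *\<^sub>R y" "(r + s) *\<^sub>R x = r *\<^sub>R x + s *\<^sub>R x"
    "r *\<^sub>R s *\<^sub>R x = (r * s) *\<^sub>R x" "1 *\<^sub>R x = x"
    by (rule ell2_eqI; simp add: seq_plus seq_scaleR algebra_simps)+
  show "complex_of_real r *\<^sub>C x = r *\<^sub>R x" "c *\<^sub>C (x + y) = c *\<^sub>C x + c *\<^sub>C y"
    "(c + d) *\<^sub>C x = c *\<^sub>C x + d *\<^sub>C x" "c *\<^sub>C d *\<^sub>C x = (c * d) *\<^sub>C x"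
    by (rule ell2_eqI; simp add: seq_plus seq_scaleR seq_scaleC algebra_simps)+
  show "dist x y = norm (x - y)" "sgn x = inverse (norm x) *\<^sub>R x" "norm x = sqrt (inner x x)"
    by (fact dist_ell2_def sgn_ell2_def norm_ell2_def)+
  show "(uniformity :: (ell2 \<times> ell2) filter) = (INF e\<in>{0 <..}. principal {(x, y). dist x y < e})"
    by (fact uniformity_ell2_def)
  show "open U \<longleftrightarrow> (\<forall>x\<in>U. \<forall>\<^sub>F (x', y) in uniformity. x' = x \<longrightarrow> y \<in> U)" for U :: "ell2 set"
    by (fact open_ell2_def)
  show comm: "cinner x y = cnj (cinner y x)" for x y :: ell2
    unfolding cinner_ell2_def
    using sums_unique[OF sums_cnj[THEN iffD2, OF summable_sums[OF summable_mult_cnj[of y x]]]]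
    by (simp add: mult.commute)
  show add: "cinner (x + y) z = cinner x z + cinner y z"
    unfolding cinner_ell2_def
    by (simp add: seq_plus distrib_right suminf_add[OF summable_mult_cnj summable_mult_cnj])
  show scale: "cinner (c *\<^sub>C x) y = c * cinner x y" for c
    unfolding cinner_ell2_def
    by (simp add: seq_scaleC mult.assoc suminf_mult[OF summable_mult_cnj])
  show re: "Re (cinner x y) = inner x y" for x y :: ell2
    by (simp add: cinner_ell2_def inner_ell2_def)
  show "inner x y = inner y x"
    using comm[of x y] by (simp flip: re)
  show "inner (x + y) z = inner x z + inner y z"
    using add by (simp flip: re)
  have "r *\<^sub>R x = complex_of_real r *\<^sub>C x"
    by (rule ell2_eqI; simp add: seq_scaleR seq_scaleC)
  then show "inner (r *\<^sub>R x) y = r * inner x y"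
    using scale[of "complex_of_real r"] by (simp flip: re)
  show "0 \<le> inner x x"
    by (simp add: inner_self_ell2 suminf_nonneg seq_summable)
  show "inner x x = 0 \<longleftrightarrow> x = 0"
    unfolding inner_self_ell2
    by (subst suminf_eq_zero_iff[OF seq_summable]) (auto intro: ell2_eqI simp: seq_zero)
qed

end

lemma norm_ell2_sq: "(norm x)\<^sup>2 = (\<Sum>n. (cmod (seq x n))\<^sup>2)" for x :: ell2
  by (simp add: power2_norm_eq_inner inner_self_ell2)

lemma seq_le_norm: "cmod (seq x n) \<le> norm x"
proof (rule power2_le_imp_le)
  have "(\<Sum>k\<in>{n}. (cmod (seq x k))\<^sup>2) \<le> (\<Sum>k. (cmod (seq x k))\<^sup>2)"
    by (rule sum_le_suminf) (auto simp: seq_summable)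
  then show "(cmod (seq x n))\<^sup>2 \<le> (norm x)\<^sup>2"
    by (simp add: norm_ell2_sq)
qed simp

instance ell2 :: chilbert_space
proof
  fix X :: "nat \<Rightarrow> ell2"
  assume C: "Cauchy X"
  have "Cauchy (\<lambda>n. seq (X n) i)" for i
  proof (rule metric_CauchyI)
    fix e :: real
    assume "0 < e"
    then obtain M where "dist (X m) (X n) < e" if "m \<ge> M" "n \<ge> M" for m n
      using metric_CauchyD[OF C] by metis
    moreover have "dist (seq (X m) i) (seq (X n) i) \<le> dist (X m) (X n)" for m n
      using seq_le_norm[of "X m - X n" i] by (simp add: dist_norm seq_minus)
    ultimately show "\<exists>M. \<forall>m\<ge>M. \<forall>n\<ge>M. dist (seq (X m) i) (seq (X n) i) < e"
      by (meson le_less_trans)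
  qed
  then have "\<exists>g. \<forall>i. (\<lambda>n. seq (X n) i) \<longlonglongrightarrow> g i"
    by (intro choice allI) (meson Cauchy_convergent convergent_def)
  then obtain g where g: "(\<lambda>n. seq (X n) i) \<longlonglongrightarrow> g i" for i
    by blast
  have bound: "(\<Sum>i<k. (cmod (seq (X m) i - g i))\<^sup>2) \<le> e\<^sup>2"
    if M: "\<forall>m\<ge>M. \<forall>n\<ge>M. dist (X m) (X n) < e" and m: "m \<ge> M" for M m k and e :: real
  proof (rule tendsto_upperbound)
    show "(\<lambda>n. \<Sum>i<k. (cmod (seq (X m) i - seq (X n) i))\<^sup>2)
        \<longlonglongrightarrow> (\<Sum>i<k. (cmod (seq (X m) i - g i))\<^sup>2)"
      by (intro tendsto_intros g)
    show "\<forall>\<^sub>F n in sequentially. (\<Sum>i<k. (cmod (seq (X m) i - seq (X n) i))\<^sup>2) \<le> e\<^sup>2"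
    proof (rule eventually_sequentiallyI)
      fix n
      assume "M \<le> n"
      have "(\<Sum>i<k. (cmod (seq (X m - X n) i))\<^sup>2) \<le> (norm (X m - X n))\<^sup>2"
        unfolding norm_ell2_sq by (rule sum_le_suminf) (auto simp: seq_summable)
      also have "\<dots> \<le> e\<^sup>2"
        using M m \<open>M \<le> n\<close> by (intro power_mono) (auto simp: dist_norm less_imp_le)
      finally show "(\<Sum>i<k. (cmod (seq (X m) i - seq (X n) i))\<^sup>2) \<le> e\<^sup>2"
        by (simp add: seq_minus)
    qed
  qed simp
  have diff_summable: "summable (\<lambda>i. (cmod (seq (X m) i - g i))\<^sup>2)"
    if "\<forall>m\<ge>M. \<forall>n\<ge>M. dist (X m) (X n) < e" "m \<ge> M" for M m and e :: real
    by (rule summableI_nonneg_bounded[OF _ bound[OF that]]) simp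
  obtain M1 where M1: "\<forall>m\<ge>M1. \<forall>n\<ge>M1. dist (X m) (X n) < 1"
    using metric_CauchyD[OF C, of 1] by auto
  have "summable (\<lambda>i. (cmod ((g i - seq (X M1) i) + seq (X M1) i))\<^sup>2)"
    using diff_summable[OF M1 order_refl]
    by (intro sq_summable_add seq_summable) (simp add: norm_minus_commute)
  then have seq_L: "seq (Abs_ell2 g) = g"
    by (simp add: seq_Abs)
  have "X \<longlonglongrightarrow> Abs_ell2 g"
  proof (rule metric_LIMSEQ_I)
    fix e :: real
    assume e: "0 < e"
    then obtain M where M: "\<forall>m\<ge>M. \<forall>n\<ge>M. dist (X m) (X n) < e / 2"
      using metric_CauchyD[OF C, of "e / 2"] by auto
    have "dist (X m) (Abs_ell2 g) < e" if m: "m \<ge> M" for m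
    proof -
      have "(norm (X m - Abs_ell2 g))\<^sup>2 = (\<Sum>i. (cmod (seq (X m) i - g i))\<^sup>2)"
        by (simp add: norm_ell2_sq seq_minus seq_L)
      also have "\<dots> \<le> (e / 2)\<^sup>2"
        by (rule suminf_le_const[OF diff_summable[OF M m] bound[OF M m]])
      finally have "norm (X m - Abs_ell2 g) \<le> e / 2"
        by (rule power2_le_imp_le) (use e in simp)
      then show ?thesis
        using e by (simp add: dist_norm)
    qed
    then show "\<exists>M. \<forall>n\<ge>M. dist (X n) (Abs_ell2 g) < e"
      by blast
  qed
  then show "convergent X"
    by (rule convergentI)
qed

definition ket :: "nat \<Rightarrow> ell2" where
  "ket n = Abs_ell2 (\<lambda>k. if k = n then 1 else 0)"

lemma seq_ket: "seq (ket n) k = (if k = n then 1 else 0)"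
proof -
  have "summable (\<lambda>k. (cmod (if k = n then 1 else 0))\<^sup>2)"
    by (rule summable_finite[of "{n}"]) auto
  then show ?thesis
    by (simp add: ket_def seq_Abs)
qed


section \<open>Weighted shifts\<close>

text \<open>
  For bounded weights the shifted sequence is square summable, and this is the bounded operator
  that sends each basis vector to a multiple of the next one.
\<close>

definition weighted_shift :: "(nat \<Rightarrow> real) \<Rightarrow> ell2 \<Rightarrow> ell2" where
  "weighted_shift w x =
     Abs_ell2 (\<lambda>n. case n of 0 \<Rightarrow> 0 | Suc m \<Rightarrow> complex_of_real (w m) * seq x m)"

lemma weighted_shift_ket: "weighted_shift w (ket n) = complex_of_real (w n) *\<^sub>C ket (Suc n)"
proof -
  have eq: "(\<lambda>k. case k of 0 \<Rightarrow> 0 | Suc m \<Rightarrow> complex_of_real (w m) * seq (ket n) m)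
      = seq (complex_of_real (w n) *\<^sub>C ket (Suc n))"
    by (auto simp: fun_eq_iff seq_scaleC seq_ket split: nat.split)
  show ?thesis
    unfolding weighted_shift_def eq by (rule seq_inverse)
qed

definition moment :: "real measure \<Rightarrow> nat \<Rightarrow> real" where
  "moment \<mu> n = (LINT t|\<mu>. t ^ n)"

definition shift_weight :: "real measure \<Rightarrow> nat \<Rightarrow> real" where
  "shift_weight \<mu> n = sqrt (moment \<mu> (Suc n) / moment \<mu> n)"

definition berger_shift :: "real measure \<Rightarrow> ell2 \<Rightarrow> ell2" where
  "berger_shift \<mu> = weighted_shift (shift_weight \<mu>)"

end

theory Submission
  imports Defs "HOL-Computational_Algebra.Computational_Algebra"
begin

text \<open>
  If the Aluthge transform is subnormal, its power moments
  \<open>\<beta> n = sqrt (\<gamma> n * \<gamma> (n + 1) / (\<gamma> 0 * \<gamma> 1))\<close> are the entries of a positive Hankel form. Since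
  \<open>\<beta>\<^sup>2\<close> is a finite sum of powers, the form degenerates, so \<open>\<beta>\<close> itself is a positive finite sum of
    powers.
  With logarithms of atoms as exponents, \<open>F * G = H\<^sup>2\<close> holds in the group ring of the reals, where
  \<open>F\<close> is supported on \<open>{0, p, 2 * p, M - 2 * q, M - q, M}\<close>, \<open>G\<close> arises from \<open>F\<close> by the substitution
  \<open>s \<mapsto> s + 1\<close>, and \<open>H\<close> has positive coefficients. Positivity confines the support of \<open>H\<close>, and comparing
  a few coefficients then forces \<open>p\<close>, \<open>q\<close>, \<open>M\<close> to be commensurable. So \<open>F\<close> becomes a polynomial with
  \<open>F(Y) * F(\<tau> * Y)\<close> a square
    for some \<open>\<tau> > 1\<close>; as scaling by \<open>\<tau>\<close> has no finite orbits, all roots of \<open>F\<close> have even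
  order, and \<open>F = r\<^sup>2\<close>. The sparsity and the signs of the coefficients of \<open>F\<close> exclude this.
\<close>

section \<open>The Aluthge transform of a weighted shift\<close>

text \<open>No spectral theorem enters: a normal extension is used only through vectors with Gram
  matrix \<open>\<beta> (k + l)\<close>, and these live in an arbitrary space. Degeneracy comes from
  the entrywise square \<open>(\<beta> (k + l))\<^sup>2\<close>, a Hankel matrix of finite rank: a
  polynomial vanishing at its bases turns a sum of squares into 0. The shift s -> s + 1 supplies the
  missing rigidity: once symmetrised, it weights a pair (u, v) of exponents of F by cosh ((u - v) /
  2), so distant pairs weigh more than the corresponding products of coefficients of H can match.
  The deficit must be made up by further pairs in the support of H, and each such pair is a linear
  relation between p, q and M. The two conditions on the atoms give a three-term progression at
  either end of the support of F; they confine the support of H to multiples of p from below and to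
  M minus multiples of q from above. The gap between the third and the fourth atom is the inequality
  2 p + 2 q < M.\<close>

lemma cinner_add_right: "cinner x (y + z) = cinner x y + cinner x z"
  by (metis cinner_add_left cinner_commute complex_cnj_add)

lemma cinner_scaleC_right: "cinner x (c *\<^sub>C y) = cnj c * cinner x y"
  by (metis cinner_scaleC_left cinner_commute complex_cnj_mult)

lemma cinner_eq_imp_eq:
  assumes "\<And>x. cinner x y = cinner x z"
  shows "y = z"
  using assms by (metis Re_cinner vector_eq_ldot)

lemma adj_eqI: "is_adjoint T S \<Longrightarrow> adj T = S"
  unfolding adj_def
proof (rule the_equality)
  fix S' assume "is_adjoint T S" "is_adjoint T S'"
  then have "cinner x (S' y) = cinner x (S y)" for x y
    by (simp add: is_adjoint_def)
  then show "S' = S" by (intro ext cinner_eq_imp_eq)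
qed

text \<open>Polarisation: the form is real at x + y and at x + i y, and the cross terms give the
  imaginary and the real part of \<open>?a = cnj ?b\<close>.\<close>

lemma positive_op_symmetric:
  assumes "positive_op B"
  shows "cinner (B x) y = cinner x (B y)"
proof -
  have add: "B (x + y) = B x + B y" for x y
    using assms by (simp add: positive_op_def bounded_clinear_def linear_simps)
  have scale: "B (c *\<^sub>C x) = c *\<^sub>C B x" for c x
    using assms by (simp add: positive_op_def bounded_clinear_def)
  have real: "Im (cinner (B x) x) = 0" for x
    using assms by (simp add: positive_op_def complex_is_Real_iff)
  let ?a = "cinner (B x) y" and ?b = "cinner (B y) x"
  have "Im (?a + ?b) = 0"
    using real[of "x + y"] real[of x] real[of y] by (simp add: add cinner_add_left cinner_add_right)
  moreover have "Re (?b - ?a) = 0"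
    using real[of "x + \<i> *\<^sub>C y"] real[of x] real[of y]
    by (simp add: add scale cinner_add_left cinner_add_right cinner_scaleC_left cinner_scaleC_right)
  ultimately have "?a = cnj ?b"
    by (simp add: complex_eq_iff)
  then show ?thesis by (metis cinner_commute)
qed

lemma cinner_ket: "cinner x (ket n) = seq x n"
proof -
  have "(\<Sum>k. seq x k * cnj (seq (ket n) k)) = (\<Sum>k\<in>{n}. seq x k * cnj (seq (ket n) k))"
    by (rule suminf_finite) (auto simp: seq_ket)
  then show ?thesis by (simp add: cinner_ell2_def seq_ket)
qed

definition diag_op :: "(nat \<Rightarrow> real) \<Rightarrow> ell2 \<Rightarrow> ell2" where
  "diag_op d x = Abs_ell2 (\<lambda>n. complex_of_real (d n) * seq x n)"

lemma sq_summable_bounded_mult: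
  assumes d: "\<And>n. \<bar>d n\<bar> \<le> B" and f: "summable (\<lambda>n. (cmod (f n))\<^sup>2)"
  shows "summable (\<lambda>n. (cmod (complex_of_real (d n) * f n))\<^sup>2)"
proof (rule summable_comparison_test'[OF summable_mult[OF f, of "B\<^sup>2"]])
  fix n
  have "(d n)\<^sup>2 \<le> B\<^sup>2" using d[of n] by (metis abs_le_square_iff abs_of_nonneg abs_ge_zero order_trans)
  then show "norm ((cmod (complex_of_real (d n) * f n))\<^sup>2) \<le> B\<^sup>2 * (cmod (f n))\<^sup>2"
    by (simp add: norm_mult power_mult_distrib mult_right_mono)
qed

lemma seq_diag_op:
  assumes "\<And>n. \<bar>d n\<bar> \<le> B"
  shows "seq (diag_op d x) n = complex_of_real (d n) * seq x n"
  unfolding diag_op_def using seq_Abs[OF sq_summable_bounded_mult[OF assms seq_summable]] by simp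

lemma bounded_clinear_ell2I:
  fixes T :: "ell2 \<Rightarrow> ell2"
  assumes "\<And>x y. T (x + y) = T x + T y" "\<And>c x. T (c *\<^sub>C x) = c *\<^sub>C T x" "\<And>x. norm (T x) \<le> K * norm x"
  shows "bounded_clinear T"
proof -
  have "T (r *\<^sub>R x) = r *\<^sub>R T x" for r x
    using assms(2)[of "complex_of_real r" x] by (simp add: scaleC_of_real)
  then have "bounded_linear T"
    using assms(1,3) by (intro bounded_linear_intro[of T K]) (simp_all add: mult.commute)
  then show ?thesis using assms(2) by (simp add: bounded_clinear_def)
qed

lemma bounded_clinear_diag_op:
  assumes d: "\<And>n. \<bar>d n\<bar> \<le> B"
  shows "bounded_clinear (diag_op d)"
proof (rule bounded_clinear_ell2I)
  show "norm (diag_op d x) \<le> B * norm x" for x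
  proof (rule power2_le_imp_le)
    have "(d n)\<^sup>2 \<le> B\<^sup>2" for n using d[of n]
      by (metis abs_le_square_iff abs_of_nonneg abs_ge_zero order_trans)
    then have "(\<Sum>n. (cmod (seq (diag_op d x) n))\<^sup>2) \<le> (\<Sum>n. B\<^sup>2 * (cmod (seq x n))\<^sup>2)"
      by (intro suminf_le seq_summable summable_mult)
        (simp add: seq_diag_op[OF d] norm_mult power_mult_distrib mult_right_mono)
    then show "(norm (diag_op d x))\<^sup>2 \<le> (B * norm x)\<^sup>2"
      by (simp add: norm_ell2_sq power_mult_distrib suminf_mult seq_summable)
    show "0 \<le> B * norm x" using d[of 0] by simp
  qed
qed (rule ell2_eqI, simp add: seq_diag_op[OF d] seq_plus seq_scaleC algebra_simps)+

lemma positive_op_diag_op: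
  assumes d: "\<And>n. \<bar>d n\<bar> \<le> B" and pos: "\<And>n. 0 \<le> d n"
  shows "positive_op (diag_op d)"
proof -
  have "cinner (diag_op d x) x = complex_of_real (\<Sum>n. d n * (cmod (seq x n))\<^sup>2)
      \<and> 0 \<le> (\<Sum>n. d n * (cmod (seq x n))\<^sup>2)" for x
  proof -
    have s: "summable (\<lambda>n. d n * (cmod (seq x n))\<^sup>2)"
      by (rule summable_comparison_test'[OF summable_mult[OF seq_summable[of x], of B]])
        (use d in \<open>simp add: abs_mult mult_right_mono\<close>)
    have "cinner (diag_op d x) x = (\<Sum>n. complex_of_real (d n * (cmod (seq x n))\<^sup>2))"
      unfolding cinner_ell2_def
      by (simp only: seq_diag_op[OF d] of_real_mult complex_norm_square mult.assoc)
    then show ?thesis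
      using suminf_of_real[OF s, where 'a = complex] suminf_nonneg[OF s] pos by simp
  qed
  then show ?thesis
    using bounded_clinear_diag_op[OF d] by (simp add: positive_op_def)
qed

lemma op_sqrt_diag_op:
  assumes d: "\<And>n. d n \<le> B" and pos: "\<And>n. 0 < d n"
  shows "op_sqrt (diag_op (\<lambda>n. (d n)\<^sup>2)) = diag_op d"
  unfolding op_sqrt_def
proof (rule the_equality)
  have ab: "\<bar>d n\<bar> \<le> B" for n using d[of n] pos[of n] by simp
  have ab2: "\<bar>(d n)\<^sup>2\<bar> \<le> B\<^sup>2" for n using d[of n] pos[of n] by (simp add: power_mono)
  show "positive_op (diag_op d) \<and> diag_op d \<circ> diag_op d = diag_op (\<lambda>n. (d n)\<^sup>2)"
  proof
    show "positive_op (diag_op d)" by (rule positive_op_diag_op[OF ab]) (simp add: pos less_imp_le)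
    show "diag_op d \<circ> diag_op d = diag_op (\<lambda>n. (d n)\<^sup>2)"
      by (rule ext, rule ell2_eqI) (simp add: seq_diag_op[OF ab] seq_diag_op[OF ab2], simp add:
        power2_eq_square)
  qed
  fix S assume S: "positive_op S \<and> S \<circ> S = diag_op (\<lambda>n. (d n)\<^sup>2)"
  then have S2: "S (S x) = diag_op (\<lambda>n. (d n)\<^sup>2) x" for x by (auto simp: fun_eq_iff)
  have lin: "linear S"
    using S by (simp add: positive_op_def bounded_clinear_def bounded_linear.linear)
  have diag_ket: "diag_op (\<lambda>n. (d n)\<^sup>2) (ket n) = (d n)\<^sup>2 *\<^sub>R ket n" for n
    by (rule ell2_eqI) (simp add: seq_diag_op[OF ab2] seq_scaleR seq_ket)
  have S_ket: "S (ket n) = d n *\<^sub>R ket n" for n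
  proof -
    \<comment> \<open>From S^2 - d^2 = (S + d) (S - d) at \<open>ket n\<close>, the vector
      \<open>y\<close> is zero or an eigenvector for \<open>- d n\<close>; positivity of
      \<open>S\<close> leaves only zero.\<close>
    define y where "y = S (ket n) - d n *\<^sub>R ket n"
    have "S y = - d n *\<^sub>R y"
      unfolding y_def
      by (simp add: linear_diff[OF lin] linear_scale[OF lin] S2 diag_ket scaleR_diff_right, simp add:
        power2_eq_square)
    moreover have "0 \<le> inner (S y) y"
      using S by (simp add: positive_op_def Re_cinner)
    ultimately have "d n * inner y y \<le> 0" by simp
    then have "inner y y \<le> 0" using pos[of n] by (simp add: mult_le_0_iff not_less)
    then have "y = 0" using inner_gt_zero_iff[of y] by linarith
    then show ?thesis by (simp add: y_def)
  qed
  show "S = diag_op d"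
  proof (rule ext, rule ell2_eqI)
    fix x n
    have "seq (S x) n = cinner x (S (ket n))"
      using S positive_op_symmetric[of S x "ket n"] by (simp only: cinner_ket)
    also have "\<dots> = complex_of_real (d n) * seq x n"
      by (simp only: S_ket cinner_scaleC_right cinner_ket scaleC_of_real[symmetric]
        complex_cnj_complex_of_real)
    finally show "seq (S x) n = seq (diag_op d x) n" by (simp add: seq_diag_op[OF ab])
  qed
qed

lemma seq_weighted_shift:
  assumes w: "\<And>n. \<bar>w n\<bar> \<le> B"
  shows "seq (weighted_shift w x) n = (case n of 0 \<Rightarrow> 0 | Suc m \<Rightarrow> complex_of_real (w m) * seq x m)"
proof -
  have "summable (\<lambda>n. (cmod (case n of 0 \<Rightarrow> 0 | Suc m \<Rightarrow> complex_of_real (w m) * seq x m))\<^sup>2)"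
    using sq_summable_bounded_mult[OF w seq_summable[of x]] by (subst summable_Suc_iff[symmetric]) simp
  then show ?thesis unfolding weighted_shift_def by (simp add: seq_Abs)
qed

lemma seq_unilateral_shift:
  "seq (weighted_shift (\<lambda>_. 1) x) n = (case n of 0 \<Rightarrow> 0 | Suc m \<Rightarrow> seq x m)"
  using seq_weighted_shift[of "\<lambda>_. 1" 1] by (simp split: nat.split)

lemma norm_unilateral_shift: "norm (weighted_shift (\<lambda>_. 1) x) = norm x"
proof -
  have "(norm (weighted_shift (\<lambda>_. 1) x))\<^sup>2 = (norm x)\<^sup>2"
    unfolding norm_ell2_sq using suminf_split_head[OF seq_summable[of "weighted_shift (\<lambda>_. 1) x"]]
    by (simp add: seq_unilateral_shift)
  then show ?thesis by simp
qed

lemma bounded_clinear_unilateral_shift: "bounded_clinear (weighted_shift (\<lambda>_. 1))"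
proof (rule bounded_clinear_ell2I)
  show "norm (weighted_shift (\<lambda>_. 1) x) \<le> 1 * norm x" for x by (simp add: norm_unilateral_shift)
qed (rule ell2_eqI, simp add: seq_unilateral_shift seq_plus seq_scaleC split: nat.split)+

lemma weighted_shift_eq:
  assumes w: "\<And>n. \<bar>w n\<bar> \<le> B"
  shows "weighted_shift w = weighted_shift (\<lambda>_. 1) \<circ> diag_op w"
  by (rule ext, rule ell2_eqI) (simp add: seq_weighted_shift[OF w] seq_unilateral_shift seq_diag_op[OF
    w] split: nat.split)

lemma adj_weighted_shift_comp:
  assumes w: "\<And>n. \<bar>w n\<bar> \<le> B"
  shows "adj (weighted_shift w) \<circ> weighted_shift w = diag_op (\<lambda>n. (w n)\<^sup>2)"
proof -
  define S where "S y = Abs_ell2 (\<lambda>n. complex_of_real (w n) * seq y (Suc n))" for y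
  have seq_S: "seq (S y) n = complex_of_real (w n) * seq y (Suc n)" for y n
    unfolding S_def
    using seq_Abs[OF sq_summable_bounded_mult[OF w, of "\<lambda>n. seq y (Suc n)"]] seq_summable[of y]
    by (simp add: summable_Suc_iff[of "\<lambda>n. (cmod (seq y n))\<^sup>2"])
  have "is_adjoint (weighted_shift w) S"
    unfolding is_adjoint_def cinner_ell2_def
  proof (intro allI)
    fix x y
    have "(\<Sum>n. seq (weighted_shift w x) n * cnj (seq y n))
        = (\<Sum>n. seq (weighted_shift w x) (Suc n) * cnj (seq y (Suc n)))"
      using suminf_split_head[OF summable_mult_cnj[of "weighted_shift w x" y]]
        by (simp add: seq_weighted_shift[OF w])
    then show "(\<Sum>n. seq (weighted_shift w x) n * cnj (seq y n)) = (\<Sum>n. seq x n * cnj (seq (S y) n))"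
      by (simp add: seq_weighted_shift[OF w] seq_S mult_ac)
  qed
  then have "adj (weighted_shift w) = S" by (rule adj_eqI)
  moreover have w2: "\<bar>(w n)\<^sup>2\<bar> \<le> B\<^sup>2" for n
    using w[of n] by (metis abs_ge_zero abs_power2 power2_abs power_mono)
  ultimately show ?thesis
    by (intro ext ell2_eqI) (simp add: seq_S seq_weighted_shift[OF w] seq_diag_op[OF w2], simp add:
      power2_eq_square)
qed

lemma aluthge_weighted_shift:
  assumes c: "0 < c" and lower: "\<And>n. c \<le> w n" and upper: "\<And>n. w n \<le> B"
  shows "aluthge (weighted_shift w) = weighted_shift (\<lambda>n. sqrt (w n * w (Suc n)))"
proof -
  let ?T = "weighted_shift w" and ?U = "weighted_shift (\<lambda>_. 1)"
  have pos: "0 < w n" for n using c lower[of n] by linarith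
  have ab: "\<bar>w n\<bar> \<le> B" for n using pos[of n] upper[of n] by simp
  have inv: "\<bar>1 / w n\<bar> \<le> 1 / c" for n
    using c lower[of n] pos[of n] by (simp add: frac_le)
  have sq: "\<bar>sqrt (w n)\<bar> \<le> sqrt B" for n using pos[of n] upper[of n] by simp
  have abs: "op_abs ?T = diag_op w"
    unfolding op_abs_def adj_weighted_shift_comp[OF ab] by (rule op_sqrt_diag_op[OF upper pos])
  have sqrt: "op_sqrt (diag_op w) = diag_op (\<lambda>n. sqrt (w n))"
    using op_sqrt_diag_op[of "\<lambda>n. sqrt (w n)" "sqrt B"] pos upper by (simp add: less_imp_le)
  \<comment> \<open>The lower bound \<open>c\<close> keeps 1 / w bounded, so
    \<open>diag_op w\<close> is onto and its product with a polar factor determines that factor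
    everywhere.\<close>
  have inverse: "diag_op w (diag_op (\<lambda>n. 1 / w n) x) = x" for x
    using pos by (intro ell2_eqI) (simp add: seq_diag_op[OF ab] seq_diag_op[OF inv] less_imp_neq[THEN
      not_sym])
  have "polar_factor ?T = ?U"
    unfolding polar_factor_def abs
  proof (rule the_equality)
    have U0: "?U x = 0 \<longleftrightarrow> x = 0" for x using norm_unilateral_shift[of x] by (metis norm_eq_zero)
    have "diag_op w x = 0 \<longleftrightarrow> x = 0" for x
    proof
      assume "diag_op w x = 0"
      then have "seq (diag_op w x) n = 0" for n by (simp add: seq_zero)
      then show "x = 0" using pos
        by (intro ell2_eqI) (simp add: seq_diag_op[OF ab] seq_zero less_imp_neq[THEN not_sym])
    next
      show "x = 0 \<Longrightarrow> diag_op w x = 0" by (intro ell2_eqI) (simp add: seq_diag_op[OF ab] seq_zero)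
    qed
    then show "partial_isometry ?U \<and> {x. ?U x = 0} = {x. ?T x = 0} \<and> ?T = ?U \<circ> diag_op w"
      using bounded_clinear_unilateral_shift
      by (auto simp: partial_isometry_def norm_unilateral_shift U0 weighted_shift_eq[OF ab])
    fix S assume "partial_isometry S \<and> {x. S x = 0} = {x. ?T x = 0} \<and> ?T = S \<circ> diag_op w"
    then have "S \<circ> diag_op w = ?U \<circ> diag_op w"
      by (simp flip: weighted_shift_eq[OF ab])
    then have "S (diag_op w y) = ?U (diag_op w y)" for y
      by (simp add: fun_eq_iff)
    from this[of "diag_op (\<lambda>n. 1 / w n) _"] show "S = ?U"
      by (simp add: inverse fun_eq_iff)
  qed
  then have "aluthge ?T = diag_op (\<lambda>n. sqrt (w n)) \<circ> ?U \<circ> diag_op (\<lambda>n. sqrt (w n))"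
    unfolding aluthge_def abs sqrt by simp
  also have "\<dots> = weighted_shift (\<lambda>n. sqrt (w n * w (Suc n)))"
  proof (rule ext, rule ell2_eqI)
    fix x n
    have ab3: "\<bar>sqrt (w n * w (Suc n))\<bar> \<le> B" for n
    proof -
      have "sqrt (w n * w (Suc n)) \<le> B"
        by (rule real_le_lsqrt) (use pos[of n] pos[of "Suc n"] upper[of n] upper[of "Suc n"] in \<open>auto
          simp: power2_eq_square intro!: mult_mono\<close>)
      then show ?thesis using pos[of n] pos[of "Suc n"] by simp
    qed
    show "seq ((diag_op (\<lambda>n. sqrt (w n)) \<circ> ?U \<circ> diag_op (\<lambda>n. sqrt (w n))) x) n
        = seq (weighted_shift (\<lambda>n. sqrt (w n * w (Suc n))) x) n"
      by (simp add: seq_weighted_shift[OF ab3] seq_unilateral_shift seq_diag_op[OF sq] split: nat.split)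
        (simp add: real_sqrt_mult)
  qed
  finally show ?thesis .
qed

text \<open>The vectors are the powers of A = N* N applied to V e_0. Normality lets N pass through
  A, so their inner products depend on k + l alone and equal the squared norm of N^(k + l) V e_0,
  which is the image of a vector of the shift.\<close>

lemma subnormal_weighted_shift_gram:
  assumes w: "\<And>n. \<bar>w n\<bar> \<le> B" and sub: "subnormal_on TYPE('k::chilbert_space) (weighted_shift w)"
  shows "\<exists>u :: nat \<Rightarrow> 'k. \<forall>k l. inner (u k) (u l) = (\<Prod>i<k + l. (w i)\<^sup>2)"
proof -
  let ?T = "weighted_shift w"
  obtain V :: "ell2 \<Rightarrow> 'k" and N M where V: "isometric_embedding V" and NV: "\<And>x. N (V x) = V (?T x)"
    and adj: "is_adjoint N M" and comm: "\<And>x. M (N x) = N (M x)"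
    using sub unfolding subnormal_on_def normal_op_def by (metis comp_apply)
  define A where "A = M \<circ> N"
  have NM: "inner (N x) y = inner x (M y)" for x y
    using adj unfolding is_adjoint_def by (metis Re_cinner)
  have A: "inner (A x) y = inner (N x) (N y)" for x y
    using NM[of y "N x"] by (simp add: A_def inner_commute)
  have NA: "(N ^^ n) (A x) = A ((N ^^ n) x)" for n x
    by (induction n) (simp_all add: A_def comm)
  have An: "inner ((A ^^ n) x) y = inner ((N ^^ n) x) ((N ^^ n) y)" for n x y
  proof (induction n arbitrary: x y)
    case (Suc n)
    have "inner ((A ^^ Suc n) x) y = inner ((A ^^ n) (A x)) y" by (simp add: funpow_swap1)
    also have "\<dots> = inner (A ((N ^^ n) x)) ((N ^^ n) y)" by (simp add: Suc.IH NA)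
    also have "\<dots> = inner ((N ^^ Suc n) x) ((N ^^ Suc n) y)" by (simp add: A)
    finally show ?case .
  qed simp
  have sym: "inner ((A ^^ k) x) ((A ^^ l) y) = inner ((A ^^ (k + l)) x) y" for k l x y
  proof (induction l arbitrary: x y)
    case (Suc l)
    have "inner ((A ^^ k) x) (A ((A ^^ l) y)) = inner (A ((A ^^ k) x)) ((A ^^ l) y)"
      by (metis A inner_commute)
    then show ?case using Suc[of "A x" y] by (simp add: funpow_swap1)
  qed simp
  have T: "(?T ^^ n) (ket 0) = complex_of_real (\<Prod>i<n. w i) *\<^sub>C ket n" for n
  proof (induction n)
    case (Suc n)
    have scale: "?T (c *\<^sub>C x) = c *\<^sub>C ?T x" for c x
      by (rule ell2_eqI) (simp add: seq_weighted_shift[OF w] seq_scaleC split: nat.split)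
    show ?case by (simp add: Suc scale weighted_shift_ket scaleC_scaleC)
  qed (use scaleC_of_real[of 1 "ket 0"] in simp)
  have N: "(N ^^ n) (V x) = V ((?T ^^ n) x)" for n x
    by (induction n) (simp_all add: NV)
  have "inner ((A ^^ k) (V (ket 0))) ((A ^^ l) (V (ket 0))) = (\<Prod>i<k + l. (w i)\<^sup>2)" for k l
  proof -
    have "inner ((A ^^ k) (V (ket 0))) ((A ^^ l) (V (ket 0)))
      = inner (V ((?T ^^ (k + l)) (ket 0))) (V ((?T ^^ (k + l)) (ket 0)))"
      by (simp only: sym) (simp only: An N)
    also have "\<dots> = Re (cinner ((?T ^^ (k + l)) (ket 0)) ((?T ^^ (k + l)) (ket 0)))"
      using V by (simp add: isometric_embedding_def Re_cinner[symmetric])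
    also have "\<dots> = (\<Prod>i<k + l. (w i)\<^sup>2)"
      by (simp add: T cinner_scaleC_left cinner_scaleC_right cinner_ket seq_scaleC seq_ket
          prod.distrib power2_eq_square flip: of_real_mult of_real_prod)
    finally show ?thesis .
  qed
  then show ?thesis by (intro exI[of _ "\<lambda>k. (A ^^ k) (V (ket 0))"] allI)
qed

section \<open>Hankel forms with finitely many atoms\<close>

definition lagrange_basis :: "real set \<Rightarrow> real \<Rightarrow> real poly" where
  "lagrange_basis S x = (\<Prod>y\<in>S - {x}. smult (1 / (x - y)) [:- y, 1:])"

lemma poly_lagrange_basis:
  assumes "finite S" "y \<in> S"
  shows "poly (lagrange_basis S x) y = (if y = x then 1 else 0)"
  unfolding lagrange_basis_def poly_prod using assms
  by (auto intro!: prod.neutral simp flip: diff_divide_distrib)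

text \<open>Combining the equations with the coefficients of the Lagrange polynomial at
  \<open>x\<close> isolates \<open>c x\<close>.\<close>

lemma power_sums_independent:
  fixes c :: "real \<Rightarrow> real"
  assumes S: "finite S" and zero: "\<And>n. (\<Sum>e\<in>S. c e * e ^ n) = 0" and x: "x \<in> S"
  shows "c x = 0"
proof -
  let ?l = "lagrange_basis S x"
  have "(\<Sum>e\<in>S. c e * poly ?l e) = (\<Sum>e\<in>S. \<Sum>i\<le>degree ?l. coeff ?l i * (c e * e ^ i))"
    by (simp add: poly_altdef sum_distrib_left mult_ac)
  also have "\<dots> = (\<Sum>i\<le>degree ?l. coeff ?l i * (\<Sum>e\<in>S. c e * e ^ i))"
    by (subst sum.swap) (simp add: sum_distrib_left)
  also have "\<dots> = 0" by (simp add: zero)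
  also have "(\<Sum>e\<in>S. c e * poly ?l e) = (\<Sum>e\<in>S. if e = x then c e else 0)"
    using S by (intro sum.cong) (auto simp: poly_lagrange_basis)
  finally show ?thesis using S x by simp
qed

section \<open>Real polynomials and their complex roots\<close>

lemma map_poly_of_real_add:
  "map_poly complex_of_real (p + q) = map_poly complex_of_real p + map_poly complex_of_real q"
  by (simp add: poly_eq_iff coeff_map_poly)

lemma map_poly_of_real_mult:
  "map_poly complex_of_real (p * q) = map_poly complex_of_real p * map_poly complex_of_real q"
  by (simp add: poly_eq_iff coeff_map_poly coeff_mult)

lemma poly_map_poly_of_real:
  "poly (map_poly complex_of_real p) (complex_of_real x) = complex_of_real (poly p x)"
  by (induction p) (simp_all add: map_poly_pCons)

text \<open>The divisor has the roots z and its conjugate. The remainder is linear with real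
  coefficients, and vanishing at a nonreal point makes it 0.\<close>

lemma real_quadratic_dvd_if_complex_root:
  fixes p :: "real poly"
  assumes z: "poly (map_poly complex_of_real p) z = 0" and im: "Im z \<noteq> 0"
  shows "[:(Re z)\<^sup>2 + (Im z)\<^sup>2, - 2 * Re z, 1:] dvd p"
proof -
  let ?q = "[:(Re z)\<^sup>2 + (Im z)\<^sup>2, - 2 * Re z, 1:]"
  let ?m = "map_poly complex_of_real"
  define r where "r = p mod ?q"
  have "r = 0 \<or> degree r < 2"
    unfolding r_def using degree_mod_less[of ?q p] by auto
  then have r: "r = [:coeff r 0, coeff r 1:]"
    by (auto simp: poly_eq_iff coeff_pCons coeff_eq_0 split: nat.split)
  have "p = p div ?q * ?q + r" by (simp only: r_def div_mult_mod_eq)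
  then have "?m p = ?m (p div ?q) * ?m ?q + ?m r"
    by (metis map_poly_of_real_add map_poly_of_real_mult)
  moreover have "poly (?m ?q) z = 0"
    by (simp add: map_poly_pCons complex_eq_iff power2_eq_square algebra_simps)
  ultimately have "poly (?m r) z = 0" using z by simp
  then have "complex_of_real (coeff r 0) + z * complex_of_real (coeff r 1) = 0"
    by (subst (asm) r) (simp add: map_poly_pCons)
  then have "coeff r 1 = 0" "coeff r 0 = 0"
    using im by (auto simp: complex_eq_iff)
  then have "r = 0" using r by simp
  then show ?thesis unfolding r_def by (simp add: mod_eq_0_iff_dvd)
qed

text \<open>The two excluded kinds of divisors say that all complex roots of \<open>p\<close> are
  real and simple. They are phrased as divisors because positivity of a Hankel form rules out
  exactly such divisors of a minimal null polynomial.\<close>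

lemma dvd_if_vanishes_on_simple_real_roots:
  fixes p f :: "real poly"
  assumes "p \<noteq> 0"
    and "\<And>x. \<not> [:- x, 1:] ^ 2 dvd p"
    and "\<And>a b. b \<noteq> 0 \<Longrightarrow> \<not> [:a\<^sup>2 + b\<^sup>2, - 2 * a, 1:] dvd p"
    and "\<And>x. poly p x = 0 \<Longrightarrow> poly f x = 0"
  shows "p dvd f"
  using assms
proof (induction "degree p" arbitrary: p f rule: less_induct)
  case less
  show ?case
  proof (cases "degree p = 0")
    case True
    then show ?thesis using less.prems(1) by (simp add: is_unit_iff_degree unit_imp_dvd)
  next
    case False
    then have "\<not> constant (poly (map_poly complex_of_real p))"
      by (simp add: constant_degree degree_map_poly)
    then obtain z where z: "poly (map_poly complex_of_real p) z = 0"
      using fundamental_theorem_of_algebra by blast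
    have "Im z = 0"
      using real_quadratic_dvd_if_complex_root[OF z] less.prems(3) by blast
    then have "z = complex_of_real (Re z)" by (simp add: complex_eq_iff)
    with z have root: "poly p (Re z) = 0"
      by (metis of_real_eq_0_iff poly_map_poly_of_real)
    then obtain p' where p': "p = [:- Re z, 1:] * p'" by (auto simp: poly_eq_0_iff_dvd dvd_def)
    obtain f' where f': "f = [:- Re z, 1:] * f'"
      using less.prems(4)[OF root] by (auto simp: poly_eq_0_iff_dvd dvd_def)
    have p'0: "p' \<noteq> 0" using p' less.prems(1) by auto
    have "p' dvd f'"
    proof (rule less.hyps)
      show "degree p' < degree p" unfolding p' using p'0 by (subst degree_mult_eq) auto
      show "poly f' x = 0" if "poly p' x = 0" for x
      proof -
        have "x \<noteq> Re z"
        proof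
          assume "x = Re z"
          with that have "[:- Re z, 1:] dvd p'" by (simp add: poly_eq_0_iff_dvd)
          then have "[:- Re z, 1:] ^ 2 dvd p" unfolding p' power2_eq_square
            by (rule mult_dvd_mono[OF dvd_refl])
          then show False using less.prems(2) by blast
        qed
        moreover have "poly f x = 0" using that by (intro less.prems(4)) (simp add: p')
        ultimately show ?thesis by (simp add: f')
      qed
      show "\<not> [:- x, 1:] ^ 2 dvd p'" for x using less.prems(2)[of x] dvd_mult unfolding p' by blast
      show "\<not> [:a\<^sup>2 + b\<^sup>2, - 2 * a, 1:] dvd p'" if "b \<noteq> 0" for a b
        using less.prems(3)[OF that, of a] dvd_mult unfolding p' by blast
    qed (fact p'0)
    then show ?thesis unfolding p' f' by (rule mult_dvd_mono[OF dvd_refl])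
  qed
qed

section \<open>Orthogonal expansions and sums of rank-one operators\<close>

lemma orthogonal_expansion:
  fixes C :: "'a::real_inner set"
  assumes C: "finite C" "pairwise orthogonal C" and x: "x \<in> span C"
  shows "x = (\<Sum>c\<in>C. (inner x c / inner c c) *\<^sub>R c)"
proof -
  let ?y = "x - (\<Sum>c\<in>C. (inner x c / inner c c) *\<^sub>R c)"
  have "inner c' ?y = 0" if "c' \<in> C" for c'
  proof -
    have "inner c' (\<Sum>c\<in>C. (inner x c / inner c c) *\<^sub>R c)
        = (\<Sum>c\<in>C. if c = c' then inner x c' else 0)"
      unfolding inner_sum_right
    proof (rule sum.cong)
      fix c assume c: "c \<in> C"
      show "inner c' ((inner x c / inner c c) *\<^sub>R c) = (if c = c' then inner x c' else 0)"
      proof (cases "c = c'")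
        case False
        then have "inner c' c = 0" using C(2) c that by (auto simp: pairwise_def orthogonal_def)
        then show ?thesis using False by simp
      qed simp
    qed simp
    also have "\<dots> = inner x c'" using C that by simp
    finally show ?thesis by (simp add: inner_diff_right inner_commute)
  qed
  then have "orthogonal ?y c" if "c \<in> C" for c
    using that by (simp add: orthogonal_def inner_commute)
  moreover have "?y \<in> span C"
    by (intro span_diff x span_sum span_scale span_base)
  ultimately have "orthogonal ?y ?y"
    using orthogonal_to_span by blast
  then show ?thesis by (simp only: orthogonal_self right_minus_eq)
qed

text \<open>
  The hypothesis says that the Hilbert-Schmidt norm of the operator
  \<open>x \<mapsto> \<Sum>k. q k \<langle>u k, x\<rangle> u k\<close> vanishes.
\<close>

lemma sum_rank_one_eq_0:
  fixes u :: "nat \<Rightarrow> 'a::real_inner"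
  assumes K: "finite K" and zero: "(\<Sum>k\<in>K. \<Sum>l\<in>K. q k * q l * (inner (u k) (u l))\<^sup>2) = 0"
    and x: "x \<in> span (u ` K)"
  shows "(\<Sum>k\<in>K. (q k * inner (u k) x) *\<^sub>R u k) = 0"
proof -
  obtain C where C: "finite C" "span C = span (u ` K)" "pairwise orthogonal C"
    using basis_orthogonal[of "u ` K"] K by auto
  define t where "t c y = inner y c / sqrt (inner c c)" for c y :: 'a
  have par: "inner y z = (\<Sum>c\<in>C. t c y * t c z)" if "y \<in> span C" for y z
  proof -
    have "inner y z = (\<Sum>c\<in>C. (inner y c / inner c c) * inner c z)"
      by (subst orthogonal_expansion[OF C(1,3) that]) (simp add: inner_sum_left)
    then show ?thesis
      by (simp add: t_def inner_commute)
  qed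
  have u: "u k \<in> span C" if "k \<in> K" for k
    using that C(2) by (simp add: span_base)
  \<comment> \<open>Matrix of the operator in the normalised vectors of \<open>C\<close>. The
    numbers \<open>q k\<close> may have any sign, but the squares of the entries add up to the
    double sum in the hypothesis, so every entry is 0.\<close>
  define s where "s c c' = (\<Sum>k\<in>K. q k * t c (u k) * t c' (u k))" for c c'
  have "(\<Sum>c\<in>C. \<Sum>c'\<in>C. (s c c')\<^sup>2)
    = (\<Sum>c\<in>C. \<Sum>c'\<in>C. \<Sum>k\<in>K. \<Sum>l\<in>K. q k * q l * (t c (u k) * t c (u l)) * (t c' (u k) * t c' (u l)))"
    unfolding s_def power2_eq_square sum_product by (intro sum.cong refl) (simp add: mult_ac)
  also have "\<dots> = (\<Sum>c\<in>C. \<Sum>k\<in>K. \<Sum>c'\<in>C. \<Sum>l\<in>K. q k * q l * (t c (u k) * t c (u l)) * (t c' (u k)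
    * t c' (u l)))"
    by (intro sum.cong refl sum.swap)
  also have "\<dots> = (\<Sum>c\<in>C. \<Sum>k\<in>K. \<Sum>l\<in>K. \<Sum>c'\<in>C. q k * q l * (t c (u k) * t c (u l)) * (t c' (u k)
    * t c' (u l)))"
    by (intro sum.cong refl sum.swap)
  also have "\<dots> = (\<Sum>k\<in>K. \<Sum>c\<in>C. \<Sum>l\<in>K. \<Sum>c'\<in>C. q k * q l * (t c (u k) * t c (u l)) * (t c' (u k)
    * t c' (u l)))"
    by (rule sum.swap)
  also have "\<dots> = (\<Sum>k\<in>K. \<Sum>l\<in>K. \<Sum>c\<in>C. \<Sum>c'\<in>C. q k * q l * (t c (u k) * t c (u l)) * (t c' (u k)
    * t c' (u l)))"
    by (intro sum.cong refl sum.swap)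
  also have "\<dots> = (\<Sum>k\<in>K. \<Sum>l\<in>K. q k * q l * (inner (u k) (u l))\<^sup>2)"
    by (intro sum.cong refl) (simp add: par u power2_eq_square sum_product sum_distrib_left mult_ac)
  finally have "(\<Sum>c\<in>C. \<Sum>c'\<in>C. (s c c')\<^sup>2) = 0" using zero by simp
  then have s0: "s c c' = 0" if "c \<in> C" "c' \<in> C" for c c'
    using that C(1) by (simp add: sum_nonneg_eq_0_iff sum_nonneg)
  let ?w = "\<Sum>k\<in>K. (q k * inner (u k) x) *\<^sub>R u k"
  have w: "?w \<in> span C" by (intro span_sum span_scale u)
  have "t c' ?w = 0" if "c' \<in> C" for c'
  proof -
    have "t c' ?w = (\<Sum>k\<in>K. q k * inner (u k) x * t c' (u k))"
      unfolding t_def by (simp add: inner_sum_left sum_divide_distrib)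
    also have "\<dots> = (\<Sum>k\<in>K. \<Sum>c\<in>C. t c x * (q k * t c (u k) * t c' (u k)))"
      by (intro sum.cong refl) (simp add: par u sum_distrib_left sum_distrib_right mult_ac)
    also have "\<dots> = (\<Sum>c\<in>C. t c x * s c c')"
      unfolding s_def by (subst sum.swap) (simp add: sum_distrib_left)
    also have "\<dots> = 0" using that s0 by simp
    finally show ?thesis .
  qed
  then have "inner ?w ?w = 0" using par[OF w] by simp
  then show ?thesis by simp
qed


section \<open>Polynomials and the Hankel form\<close>

locale hankel_gram =
  fixes u :: "nat \<Rightarrow> 'a::real_inner" and \<beta> :: "nat \<Rightarrow> real"
  assumes gram: "inner (u k) (u l) = \<beta> (k + l)"
begin

text \<open>Linear extension of X^i to \<open>u i\<close>. It pulls the inner product back to (f, g)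
  -> L (f g), where L sends X^n to \<open>\<beta> n\<close>; hence multiplication by a polynomial is
  symmetric.\<close>

definition vec :: "real poly \<Rightarrow> 'a" where
  "vec f = (\<Sum>i\<le>degree f. coeff f i *\<^sub>R u i)"

lemma vec_upto: "degree f \<le> n \<Longrightarrow> vec f = (\<Sum>i\<le>n. coeff f i *\<^sub>R u i)"
  unfolding vec_def by (rule sum.mono_neutral_left) (auto simp: coeff_eq_0)

lemma vec_add: "vec (f + g) = vec f + vec g"
proof -
  let ?n = "max (degree f) (degree g)"
  have "degree (f + g) \<le> ?n" by (rule degree_add_le_max)
  then show ?thesis
    by (simp add: vec_upto[of _ ?n] scaleR_add_left sum.distrib)
qed

lemma vec_smult: "vec (smult c f) = c *\<^sub>R vec f"
  by (simp add: vec_upto[of _ "degree f"] degree_smult_le scaleR_sum_right)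

lemma vec_0 [simp]: "vec 0 = 0"
  by (simp add: vec_def)

lemma vec_sum: "vec (sum f A) = (\<Sum>a\<in>A. vec (f a))"
  by (induction A rule: infinite_finite_induct) (simp_all add: vec_add)

lemma vec_diff: "vec (f - g) = vec f - vec g"
  using vec_add[of f "- g"] vec_smult[of "-1" g] by simp

lemma vec_monom: "vec (monom c n) = c *\<^sub>R u n"
  by (simp add: vec_upto[of _ n] degree_monom_le if_distrib[of "\<lambda>c. c *\<^sub>R _"] cong: if_cong)

lemma vec_pCons_0: "vec (pCons 0 f) = (\<Sum>i\<le>degree f. coeff f i *\<^sub>R u (Suc i))"
proof -
  have "vec (pCons 0 f) = (\<Sum>i\<le>Suc (degree f). coeff (pCons 0 f) i *\<^sub>R u i)"
    by (rule vec_upto) (rule degree_pCons_le)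
  then show ?thesis by (subst (asm) sum.atMost_Suc_shift) simp
qed

lemma inner_vec_pCons_0: "inner (vec (pCons 0 f)) (vec g) = inner (vec f) (vec (pCons 0 g))"
  unfolding vec_pCons_0 unfolding vec_def
  by (simp add: inner_sum_left inner_sum_right gram)

lemma inner_vec_mult: "inner (vec (f * g)) (vec h) = inner (vec g) (vec (f * h))"
proof (induction f arbitrary: g h)
  case (pCons a f)
  have "inner (vec (pCons a f * g)) (vec h)
    = a * inner (vec g) (vec h) + inner (vec (pCons 0 (f * g))) (vec h)"
    by (simp add: vec_add vec_smult inner_add_left)
  also have "inner (vec (pCons 0 (f * g))) (vec h) = inner (vec g) (vec (pCons 0 (f * h)))"
    using pCons.IH[of g "pCons 0 h"] by (simp add: inner_vec_pCons_0)
  finally show ?case by (simp add: vec_add vec_smult inner_add_right)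
qed simp

text \<open>The null polynomials form an ideal: the squared norm of \<open>vec (g * f)\<close> is
  the inner product of \<open>vec f\<close> with another vector.\<close>

lemma vec_mult_eq_0: "vec f = 0 \<Longrightarrow> vec (g * f) = 0"
  using inner_vec_mult[of g f "g * f"] by simp

lemma inner_vec_u0: "inner (vec f) (vec f) = inner (vec (f\<^sup>2)) (u 0)"
  using inner_vec_mult[of f f 1] vec_monom[of 1 0] by (simp add: power2_eq_square inner_commute)

text \<open>Gauss quadrature in algebraic form: a null polynomial of least degree has only simple
  real roots, which serve as nodes, and reduction modulo it expresses every moment by the weights at
  the nodes.\<close>

lemma finitely_atomic:
  assumes "\<exists>f. f \<noteq> 0 \<and> vec f = 0"
  shows "\<exists>R h. finite R \<and> (\<forall>x\<in>R. 0 < h x) \<and> (\<forall>n. \<beta> n = (\<Sum>x\<in>R. h x * x ^ n))"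
proof -
  obtain p where p: "p \<noteq> 0" "vec p = 0" and min: "\<And>f. f \<noteq> 0 \<Longrightarrow> vec f = 0 \<Longrightarrow> degree p \<le> degree f"
    using exists_least_iff[of "\<lambda>n. \<exists>f. f \<noteq> 0 \<and> vec f = 0 \<and> degree f = n"] assms
    by (metis (no_types, lifting) not_le)
  have no_double: "\<not> [:- x, 1:] ^ 2 dvd p" for x
  proof
    assume "[:- x, 1:] ^ 2 dvd p"
    then obtain f where f: "p = [:- x, 1:] ^ 2 * f" by (auto simp: dvd_def)
    \<comment> \<open>The squared norm of \<open>vec ?g\<close> is the inner product of
      \<open>vec f\<close> with \<open>vec p\<close>, so \<open>?g\<close> would be a null
      polynomial of smaller degree.\<close>
    let ?g = "[:- x, 1:] * f"
    have "inner (vec ?g) (vec ?g) = inner (vec f) (vec ([:- x, 1:] * ?g))"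
      by (rule inner_vec_mult)
    also have xg: "[:- x, 1:] * ?g = p" by (simp only: f power2_eq_square mult.assoc)
    finally have "vec ?g = 0" using p by simp
    moreover have "f \<noteq> 0" using p f by auto
    then have "?g \<noteq> 0" by (simp only: mult_eq_0_iff) simp
    ultimately have "degree p \<le> degree ?g" by (intro min)
    moreover have "degree p = degree [:- x, 1:] + degree ?g"
      using \<open>?g \<noteq> 0\<close> by (simp only: xg[symmetric]) (rule degree_mult_eq, auto)
    ultimately show False by simp
  qed
  have no_quadratic: "\<not> [:a\<^sup>2 + b\<^sup>2, - 2 * a, 1:] dvd p" if "b \<noteq> 0" for a b
  proof
    assume "[:a\<^sup>2 + b\<^sup>2, - 2 * a, 1:] dvd p"
    then obtain f where f: "p = [:a\<^sup>2 + b\<^sup>2, - 2 * a, 1:] * f" by (auto simp: dvd_def)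
    \<comment> \<open>Completing the square, p = (X - a)^2 f + b^2 f. Pairing with
      \<open>vec f\<close> writes 0 as a sum of two nonnegative terms, so \<open>f\<close> would be
      null.\<close>
    let ?g = "[:- a, 1:] * f"
    have "[:a\<^sup>2 + b\<^sup>2, - 2 * a, 1:] = [:- a, 1:] * [:- a, 1:] + [:b\<^sup>2:]"
      by (simp add: power2_eq_square)
    then have "p = [:- a, 1:] * ?g + smult (b\<^sup>2) f"
      unfolding f by (simp only: distrib_right mult.assoc) simp
    then have "0 = inner (vec f) (vec ([:- a, 1:] * ?g + smult (b\<^sup>2) f))"
      using p by simp
    also have "\<dots> = inner (vec ?g) (vec ?g) + b\<^sup>2 * inner (vec f) (vec f)"
      unfolding vec_add vec_smult inner_add_right inner_vec_mult[symmetric] by simp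
    finally have "b\<^sup>2 * inner (vec f) (vec f) \<le> 0"
      using inner_ge_zero[of "vec ?g"] by linarith
    then have "vec f = 0" using \<open>b \<noteq> 0\<close>
      by (metis inner_ge_zero inner_gt_zero_iff mult_pos_pos not_le zero_less_power2)
    moreover have "f \<noteq> 0" using p f by auto
    ultimately have "degree p \<le> degree f" by (intro min)
    then show False using \<open>f \<noteq> 0\<close> by (simp add: f degree_mult_eq del: mult_pCons_left)
  qed
  define S where "S = {x. poly p x = 0}"
  have S: "finite S" unfolding S_def using p(1) by (rule poly_roots_finite)
  define h where "h x = inner (vec (lagrange_basis S x)) (vec (lagrange_basis S x))" for x
  have "\<beta> n = (\<Sum>x\<in>S. h x * x ^ n)" for n
  proof -
    \<comment> \<open>Squared Lagrange polynomials interpolate on \<open>S\<close> as well as the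
      plain ones, and they make each weight a squared norm.\<close>
    let ?f = "monom 1 n - (\<Sum>x\<in>S. smult (x ^ n) ((lagrange_basis S x)\<^sup>2))"
    have "poly ?f y = 0" if "y \<in> S" for y
    proof -
      have "(\<Sum>x\<in>S. x ^ n * (poly (lagrange_basis S x) y)\<^sup>2) = (\<Sum>x\<in>S. if x = y then y ^ n else 0)"
        using S that by (intro sum.cong) (auto simp: poly_lagrange_basis)
      then show ?thesis using S that by (simp add: poly_sum poly_monom)
    qed
    then have "p dvd ?f"
      using p(1) no_double no_quadratic
        by (intro dvd_if_vanishes_on_simple_real_roots) (auto simp: S_def)
    then have "vec ?f = 0" by (metis dvdE mult.commute p(2) vec_mult_eq_0)
    then have "u n = (\<Sum>x\<in>S. x ^ n *\<^sub>R vec ((lagrange_basis S x)\<^sup>2))"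
      by (simp add: vec_diff vec_sum vec_smult vec_monom)
    then have "inner (u n) (u 0) = (\<Sum>x\<in>S. x ^ n * inner (vec ((lagrange_basis S x)\<^sup>2)) (u 0))"
      by (simp add: inner_sum_left)
    then show ?thesis by (simp add: gram h_def inner_vec_u0 mult.commute)
  qed
  then have "\<beta> n = (\<Sum>x\<in>{x\<in>S. h x \<noteq> 0}. h x * x ^ n)" for n
    using S by (subst sum.mono_neutral_left[of S]) auto
  moreover have "0 \<le> h x" for x by (simp add: h_def)
  ultimately show ?thesis
    using S by (intro exI[of _ "{x\<in>S. h x \<noteq> 0}"] exI[of _ h]) (auto simp: less_le)
qed

text \<open>For q with root set \<open>S\<close> the quadratic form of the squared Hankel matrix at
  the coefficients of q is the sum of d e * q(e)^2, that is 0. The rank-one sum therefore vanishes;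
  applied to \<open>u 0\<close> it is a null relation with coefficients
  \<open>coeff q k * \<beta> k\<close>, nontrivial because no \<open>\<beta> k\<close> is 0.\<close>

lemma finitely_atomic_if_square:
  assumes S: "finite S" and sq: "\<And>n. (\<beta> n)\<^sup>2 = (\<Sum>e\<in>S. d e * e ^ n)" and nz: "\<And>n. \<beta> n \<noteq> 0"
  shows "\<exists>R h. finite R \<and> (\<forall>x\<in>R. 0 < h x) \<and> (\<forall>n. \<beta> n = (\<Sum>x\<in>R. h x * x ^ n))"
proof (rule finitely_atomic)
  define q where "q = (\<Prod>e\<in>S. [:- e, 1:])"
  define f where "f = (\<Sum>k\<le>degree q. monom (coeff q k * \<beta> k) k)"
  have q0: "q \<noteq> 0" unfolding q_def using S by auto
  have qS: "poly q e = 0" if "e \<in> S" for e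
    unfolding q_def using S that by (auto simp: poly_prod prod_zero_iff)
  have "(\<Sum>k\<le>degree q. \<Sum>l\<le>degree q. coeff q k * coeff q l * (inner (u k) (u l))\<^sup>2)
      = (\<Sum>k\<le>degree q. \<Sum>l\<le>degree q. \<Sum>e\<in>S. d e * (coeff q k * e ^ k) * (coeff q l * e ^ l))"
    by (simp add: gram sq sum_distrib_left power_add mult_ac)
  also have "\<dots> = (\<Sum>k\<le>degree q. \<Sum>e\<in>S. \<Sum>l\<le>degree q. d e * (coeff q k * e ^ k) * (coeff q l * e ^ l))"
    by (intro sum.cong refl sum.swap)
  also have "\<dots> = (\<Sum>e\<in>S. \<Sum>k\<le>degree q. \<Sum>l\<le>degree q. d e * (coeff q k * e ^ k) * (coeff q l * e ^ l))"
    by (rule sum.swap)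
  also have "\<dots> = (\<Sum>e\<in>S. d e * poly q e * poly q e)"
    by (simp add: poly_altdef sum_product sum_distrib_left mult_ac)
  also have "\<dots> = 0" using qS by simp
  finally have "(\<Sum>k\<le>degree q. (coeff q k * inner (u k) (u 0)) *\<^sub>R u k) = 0"
    by (intro sum_rank_one_eq_0 span_base) auto
  then have "vec f = 0" by (simp add: f_def vec_sum vec_monom gram)
  moreover have "coeff f (degree q) = coeff q (degree q) * \<beta> (degree q)"
    unfolding f_def by (simp add: coeff_sum)
  then have "f \<noteq> 0" using q0 nz by (metis coeff_0 leading_coeff_0_iff mult_eq_0_iff)
  ultimately show "\<exists>f. f \<noteq> 0 \<and> vec f = 0" by blast
qed

end

section \<open>Polynomial squares\<close>

lemma order_pcompose_scale:
  fixes p :: "'a::field poly"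
  assumes "c \<noteq> 0" "p \<noteq> 0"
  shows "order z (p \<circ>\<^sub>p [:0, c:]) = order (c * z) p"
proof -
  let ?a = "c * z"
  obtain q where q: "p = [:-?a, 1:] ^ order ?a p * q" "\<not> [:-?a, 1:] dvd q"
    using order_decomp[OF assms(2)] by blast
  have qa: "poly q ?a \<noteq> 0"
    using q(2) by (simp add: poly_eq_0_iff_dvd)
  have pw: "(f ^ n) \<circ>\<^sub>p g = (f \<circ>\<^sub>p g) ^ n" for f g :: "'a poly" and n
    by (induction n) (simp_all add: pcompose_mult pcompose_1)
  have lin: "[:-?a, 1:] \<circ>\<^sub>p [:0, c:] = smult c [:-z, 1:]"
    by (simp add: pcompose_pCons)
  have nz: "q \<circ>\<^sub>p [:0, c:] \<noteq> 0"
    using qa by (metis (no_types) mult.commute poly_0 poly_pCons poly_pcompose add_0 mult_zero_right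
      add.right_neutral)
  have "p \<circ>\<^sub>p [:0, c:] = ([:-?a, 1:] \<circ>\<^sub>p [:0, c:]) ^ order ?a p * (q \<circ>\<^sub>p [:0, c:])"
    by (subst q(1)) (simp only: pcompose_mult pw)
  also have "\<dots> = smult (c ^ order ?a p) ([:-z, 1:] ^ order ?a p * (q \<circ>\<^sub>p [:0, c:]))"
    by (simp only: lin smult_power mult_smult_left)
  finally have "order z (p \<circ>\<^sub>p [:0, c:]) = order z ([:-z, 1:] ^ order ?a p * (q \<circ>\<^sub>p [:0, c:]))"
    using assms(1) by (simp add: order_smult)
  also have "\<dots> = order ?a p + order z (q \<circ>\<^sub>p [:0, c:])"
    using nz by (subst order_mult) (auto simp: order_power_n_n)
  also have "order z (q \<circ>\<^sub>p [:0, c:]) = 0"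
    using qa by (intro order_0I) (simp add: poly_pcompose mult.commute)
  finally show ?thesis by simp
qed

lemma even_order_if_scaled_product_square:
  fixes p h :: "complex poly"
  assumes c: "cmod c > 1" and p0: "poly p 0 \<noteq> 0" and eq: "p * (p \<circ>\<^sub>p [:0, c:]) = h ^ 2"
  shows "even (order z p)"
\<comment> \<open>The origin is the only point with a finite orbit under scaling by
  \<open>c\<close>, and \<open>p\<close> does not vanish there.\<close>
proof (cases "z = 0")
  case True
  then show ?thesis using p0 by (simp add: order_0I)
next
  case False
  have [simp]: "p \<noteq> 0" "c \<noteq> 0" using p0 c by auto
  have pc: "p \<circ>\<^sub>p [:0, c:] \<noteq> 0"
    using p0 by (metis mult_zero_left mult_zero_right poly_0 poly_pcompose add_0 poly_pCons)
  have step: "even (order (c * w) p) = even (order w p)" for w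
  proof -
    have "order w p + order (c * w) p = order w (p * (p \<circ>\<^sub>p [:0, c:]))"
      using pc by (subst order_mult) (auto simp: order_pcompose_scale)
    also have "\<dots> = 2 * order w h"
      using eq pc by (cases "h = 0") (auto simp: power2_eq_square order_mult)
    finally show ?thesis by presburger
  qed
  have iter: "even (order (c ^ n * z) p) = even (order z p)" for n
    by (induction n) (auto simp: step mult.assoc)
  have "inj (\<lambda>n. c ^ n * z)"
  proof (rule injI)
    fix m n assume "c ^ m * z = c ^ n * z"
    then have "cmod c ^ m = cmod c ^ n" using False by (metis mult_right_cancel norm_power)
    then show "m = n" using c by (simp add: power_inject_exp)
  qed
  then have "\<not> range (\<lambda>n. c ^ n * z) \<subseteq> {w. poly p w = 0}"
    using poly_roots_finite[of p] by (meson \<open>p \<noteq> 0\<close> finite_subset range_inj_infinite)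
  then obtain n where "poly p (c ^ n * z) \<noteq> 0" by auto
  then have "order (c ^ n * z) p = 0" by (rule order_0I)
  then show ?thesis using iter[of n] by simp
qed

lemma complex_poly_square_if_even_order:
  fixes p :: "complex poly"
  assumes "\<And>z. even (order z p)"
  shows "\<exists>q. p = q ^ 2"
proof -
  let ?R = "{z. poly p z = 0}"
  define q where "q = smult (csqrt (lead_coeff p)) (\<Prod>z\<in>?R. [:-z, 1:] ^ (order z p div 2))"
  have "q ^ 2 = smult (lead_coeff p) (\<Prod>z\<in>?R. ([:-z, 1:] ^ (order z p div 2)) ^ 2)"
    unfolding q_def by (simp add: smult_power prod_power_distrib)
  also have "\<dots> = smult (lead_coeff p) (\<Prod>z\<in>?R. [:-z, 1:] ^ order z p)"
    using assms by (simp add: power_mult[symmetric])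
  also have "\<dots> = p" by (rule complex_poly_decompose)
  finally show ?thesis by metis
qed

text \<open>The constant coefficient of \<open>q\<close> is real and nonzero because its square is
  positive. The Cauchy product then yields every later coefficient from earlier ones by dividing by
  twice the constant one.\<close>

lemma real_poly_square_if_complex_square:
  fixes p :: "real poly"
  assumes q: "map_poly complex_of_real p = q ^ 2" and p0: "coeff p 0 > 0"
  shows "\<exists>r. p = r ^ 2"
proof -
  have cq: "complex_of_real (coeff p n) = (\<Sum>i\<le>n. coeff q i * coeff q (n - i))" for n
    using arg_cong[OF q, of "\<lambda>f. coeff f n"]
    by (simp add: coeff_map_poly power2_eq_square coeff_mult)
  have "coeff q 0 ^ 2 = complex_of_real (sqrt (coeff p 0)) ^ 2"
    using cq[of 0] p0 by (simp add: power2_eq_square flip: of_real_mult)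
  then have q0: "coeff q 0 \<in> \<real>" "coeff q 0 \<noteq> 0"
    using p0 by (auto simp: power2_eq_iff)
  have real: "coeff q n \<in> \<real>" for n
  proof (induction n rule: less_induct)
    case (less n)
    show ?case
    proof (cases n)
      case (Suc m)
      have "complex_of_real (coeff p n)
        = 2 * coeff q 0 * coeff q n + (\<Sum>i\<in>{0<..<n}. coeff q i * coeff q (n - i))"
      proof -
        have "{..n} = insert 0 (insert n {0<..<n})" using Suc by auto
        then show ?thesis using cq[of n] Suc by simp
      qed
      then have "coeff q n = (complex_of_real (coeff p n) - (\<Sum>i\<in>{0<..<n}. coeff q i
        * coeff q (n - i))) / (2 * coeff q 0)"
        using q0 by (simp add: field_simps)
      also have "\<dots> \<in> \<real>"
        using q0 less by (intro Reals_divide Reals_diff Reals_of_real Reals_mult sum_in_Reals) auto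
      finally show ?thesis .
    qed (use q0 in simp)
  qed
  define r where "r = map_poly Re q"
  have "coeff p n = coeff (r ^ 2) n" for n
  proof -
    have "complex_of_real (coeff p n) = complex_of_real (\<Sum>i\<le>n. Re (coeff q i) * Re (coeff q (n - i)))"
      unfolding cq of_real_sum of_real_mult using real by (simp add: of_real_Re)
    then show ?thesis
      unfolding of_real_eq_iff r_def power2_eq_square coeff_mult by (simp add: coeff_map_poly)
  qed
  then show ?thesis using poly_eqI by blast
qed

lemma real_poly_square_if_scaled_product_square:
  fixes p h :: "real poly"
  assumes c: "c > 1" and p0: "coeff p 0 > 0" and eq: "p * (p \<circ>\<^sub>p [:0, c:]) = h ^ 2"
  shows "\<exists>r. p = r ^ 2"
proof -
  let ?m = "map_poly complex_of_real"
  have "?m (a \<circ>\<^sub>p [:0, c:]) = ?m a \<circ>\<^sub>p [:0, complex_of_real c:]" for a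
    by (induction a) (simp_all add: pcompose_pCons map_poly_pCons poly_eq_iff coeff_map_poly coeff_mult
      coeff_pCons split: nat.split)
  then have "?m p * (?m p \<circ>\<^sub>p [:0, complex_of_real c:]) = ?m h ^ 2"
    using arg_cong[OF eq, of ?m] by (simp add: map_poly_of_real_mult power2_eq_square)
  moreover have "poly (?m p) 0 \<noteq> 0"
    using p0 by (simp add: poly_0_coeff_0 coeff_map_poly)
  ultimately have "even (order z (?m p))" for z
    using even_order_if_scaled_product_square[of "complex_of_real c" "?m p" "?m h" z] c by simp
  then obtain q where "?m p = q ^ 2"
    using complex_poly_square_if_even_order by blast
  then show ?thesis
    using real_poly_square_if_complex_square p0 by blast
qed

section \<open>Real polynomials with a sparse square\<close>

locale sparse_square =
  fixes r :: "real poly" and k j d :: nat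
  assumes deg: "degree r = d" and k0: "0 < k" and j0: "0 < j" and kj: "k + j < d"
    and pos: "\<And>i. i \<in> {0, k, 2 * k, 2 * d - 2 * j, 2 * d - j, 2 * d} \<Longrightarrow> 0 < coeff (r ^ 2) i"
    and zero: "\<And>i. i \<notin> {0, k, 2 * k, 2 * d - 2 * j, 2 * d - j, 2 * d} \<Longrightarrow> coeff (r ^ 2) i = 0"
begin

lemma coeff_sq: "coeff (r ^ 2) n = (\<Sum>i\<le>n. coeff r i * coeff r (n - i))"
  by (simp add: power2_eq_square coeff_mult)

lemma coeff_0: "coeff r 0 \<noteq> 0"
  using pos[of 0] coeff_sq[of 0] by auto

lemma coeff_sq_split:
  assumes "0 < n"
  shows "coeff (r ^ 2) n = 2 * coeff r 0 * coeff r n + (\<Sum>i\<in>{0<..<n}. coeff r i * coeff r (n - i))"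
proof -
  have "{..n} = insert 0 (insert n {0<..<n})" using assms by auto
  then show ?thesis using coeff_sq[of n] assms by simp
qed

text \<open>Below 2 d - 2 j the square has only exponents divisible by \<open>k\<close>, and there
  the recursion for the coefficients of a square root never leaves the multiples of
  \<open>k\<close>.\<close>

lemma coeff_low: "i < 2 * d - 2 * j \<Longrightarrow> \<not> k dvd i \<Longrightarrow> coeff r i = 0"
proof (induction i rule: less_induct)
  case (less i)
  have "0 < i" using less.prems by (cases i) auto
  have "(\<Sum>m\<in>{0<..<i}. coeff r m * coeff r (i - m)) = 0"
  proof (rule sum.neutral, intro ballI)
    fix m assume m: "m \<in> {0<..<i}"
    then have "\<not> k dvd m \<or> \<not> k dvd (i - m)"
      using less.prems(2) by (metis dvd_add greaterThanLessThan_iff le_add_diff_inverse less_imp_le)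
    then show "coeff r m * coeff r (i - m) = 0"
      using less.IH[of m] less.IH[of "i - m"] m less.prems(1) by auto
  qed
  moreover have "coeff (r ^ 2) i = 0"
    using less.prems \<open>0 < i\<close> by (intro zero) (auto simp: dvd_def)
  ultimately show ?case
    using coeff_sq_split[OF \<open>0 < i\<close>] coeff_0 by simp
qed

lemma coeff_k: "0 < coeff r 0 * coeff r k"
proof -
  have "(\<Sum>m\<in>{0<..<k}. coeff r m * coeff r (k - m)) = 0"
    using kj by (intro sum.neutral) (auto simp: coeff_low nat_dvd_not_less)
  then show ?thesis
    using coeff_sq_split[OF k0] pos[of k] by simp
qed

text \<open>Reversing coefficients exchanges the two ends, so facts about small exponents transfer
  to large ones with \<open>k\<close> and \<open>j\<close> swapped.\<close>

lemma reflect: "sparse_square (reflect_poly r) j k d"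
proof -
  have r2: "degree (r ^ 2) = 2 * d"
    using coeff_0 by (subst degree_power_eq) (auto simp: deg)
  have c: "coeff (reflect_poly r ^ 2) i = (if i \<le> 2 * d then coeff (r ^ 2) (2 * d - i) else 0)" for i
    by (simp add: reflect_poly_power[symmetric] coeff_reflect_poly r2)
  show ?thesis
  proof
    show "degree (reflect_poly r) = d" using deg coeff_0 by simp
    fix i
    show "0 < coeff (reflect_poly r ^ 2) i" if i: "i \<in> {0, j, 2 * j, 2 * d - 2 * k, 2 * d - k, 2 * d}"
    proof -
      have "2 * d - i \<in> {0, k, 2 * k, 2 * d - 2 * j, 2 * d - j, 2 * d}" "i \<le> 2 * d"
        using i kj by auto
      then show ?thesis unfolding c using pos by simp
    qed
    show "coeff (reflect_poly r ^ 2) i = 0" if i: "i \<notin> {0, j, 2 * j, 2 * d - 2 * k, 2 * d - k, 2 * d}"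
    proof -
      have "2 * d - i \<notin> {0, k, 2 * k, 2 * d - 2 * j, 2 * d - j, 2 * d}" if "i \<le> 2 * d"
      proof
        assume "2 * d - i \<in> {0, k, 2 * k, 2 * d - 2 * j, 2 * d - j, 2 * d}"
        then have "i \<in> (-) (2 * d) ` {0, k, 2 * k, 2 * d - 2 * j, 2 * d - j, 2 * d}"
          using that by (metis diff_diff_cancel image_eqI)
        also have "\<dots> = {2 * d, 2 * d - k, 2 * d - 2 * k, 2 * j, j, 0}"
          using kj by simp
        finally show False using i by blast
      qed
      then show ?thesis unfolding c using zero[of "2 * d - i"] by auto
    qed
  qed (use k0 j0 kj in auto)
qed

lemma coeff_high: "0 < coeff r d * coeff r (d - j)"
  using sparse_square.coeff_k[OF reflect] kj by (simp add: coeff_reflect_poly deg)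

text \<open>Both d and d - j lie below 2 d - 2 j, and \<open>r\<close> has nonzero coefficients
  there.\<close>

lemma dvd_if_large:
  assumes "2 * j < d"
  shows "k dvd d" "k dvd j"
proof -
  show d: "k dvd d" using coeff_low[of d] coeff_high assms by force
  have "k dvd d - j" using coeff_low[of "d - j"] coeff_high assms by force
  then show "k dvd j" using d kj
    by (metis dvd_diff_nat diff_diff_cancel less_imp_le add_lessD1 add.commute)
qed

text \<open>Since k + j < d, one of 2 j < d and 2 k < d holds. The first gives k dvd j, hence also 2
  k < d and by reflection j dvd k; the second alone gives j dvd k, contradicting k < j.\<close>

lemma eq_and_dvd: "j = k" "k dvd d"
proof -
  interpret R: sparse_square "reflect_poly r" j k d by (rule reflect)
  show "j = k"
  proof (cases "2 * j < d")
    case True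
    then have "k dvd j" using dvd_if_large by simp
    then have "2 * k < d" using True j0 by (meson dvd_imp_le le_less_trans mult_le_mono2)
    then show ?thesis using R.dvd_if_large(2) \<open>k dvd j\<close> by (simp add: dvd_antisym)
  next
    case False
    then have "k < j" "2 * k < d" using kj by auto
    then show ?thesis using R.dvd_if_large(2) k0 by (simp add: nat_dvd_not_less)
  qed
  then have "2 * j < d" using kj by simp
  then show "k dvd d" by (rule dvd_if_large)
qed

text \<open>With s = r^2 and D = X d/dX one has 2 s D r = r D s. If d > 4 k, then d + 2 k lies below
  the upper cluster 2 d - 2 k of s, so in degree d + 2 k only the product of the coefficients s_(2
  k) and r_d survives on either side, with factors 2 d and 2 k; hence d = k, contrary to k + j <
  d.\<close>

lemma degree_le: "d \<le> 4 * k"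
proof (rule ccontr)
  assume d: "\<not> d \<le> 4 * k"
  let ?t = "d + 2 * k"
  let ?D = "\<lambda>p. pCons 0 (pderiv p) :: real poly"
  have D: "coeff (?D p) n = of_nat n * coeff p n" for p n
    by (cases n) (auto simp: coeff_pderiv)
  have "r ^ 2 * (?D r + ?D r) = ?D (r ^ 2) * r"
  proof -
    have "?D (r ^ 2) = r * (?D r + ?D r)"
      by (simp add: power2_eq_square pderiv_mult)
    then show ?thesis by (metis mult.assoc mult.commute power2_eq_square)
  qed
  then have "coeff (r ^ 2 * (?D r + ?D r)) ?t = coeff (?D (r ^ 2) * r) ?t" by simp
  moreover have "coeff (r ^ 2 * (?D r + ?D r)) ?t
    = coeff (r ^ 2) (2 * k) * (real d * coeff r d + real d * coeff r d)"
  proof -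
    have "coeff (r ^ 2 * (?D r + ?D r)) ?t
      = (\<Sum>i\<le>?t. coeff (r ^ 2) i * (real (?t - i) * coeff r (?t - i) + real (?t - i)
        * coeff r (?t - i)))"
      by (simp only: coeff_mult coeff_add D)
    also have "\<dots> = (\<Sum>i\<in>{2 * k}. coeff (r ^ 2) i * (real (?t - i) * coeff r (?t - i) + real (?t - i)
      * coeff r (?t - i)))"
    proof (rule sum.mono_neutral_right)
      show "\<forall>i\<in>{..?t} - {2 * k}. coeff (r ^ 2) i * (real (?t - i) * coeff r (?t - i) + real (?t - i)
        * coeff r (?t - i)) = 0"
      proof
        fix i assume "i \<in> {..?t} - {2 * k}"
        then have "?t - i > d \<or> i \<notin> {0, k, 2 * k, 2 * d - 2 * j, 2 * d - j, 2 * d}"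
          using d eq_and_dvd(1) k0 by auto
        then show "coeff (r ^ 2) i * (real (?t - i) * coeff r (?t - i) + real (?t - i)
          * coeff r (?t - i)) = 0"
          using zero coeff_eq_0[of r] deg by auto
      qed
    qed auto
    finally show ?thesis by simp
  qed
  moreover have "coeff (?D (r ^ 2) * r) ?t = real (2 * k) * coeff (r ^ 2) (2 * k) * coeff r d"
  proof -
    have "coeff (?D (r ^ 2) * r) ?t = (\<Sum>i\<le>?t. real i * coeff (r ^ 2) i * coeff r (?t - i))"
      by (simp only: coeff_mult D)
    also have "\<dots> = (\<Sum>i\<in>{2 * k}. real i * coeff (r ^ 2) i * coeff r (?t - i))"
    proof (rule sum.mono_neutral_right)
      show "\<forall>i\<in>{..?t} - {2 * k}. real i * coeff (r ^ 2) i * coeff r (?t - i) = 0"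
      proof
        fix i assume "i \<in> {..?t} - {2 * k}"
        then have "?t - i > d \<or> i \<notin> {0, k, 2 * k, 2 * d - 2 * j, 2 * d - j, 2 * d}"
          using d eq_and_dvd(1) k0 by auto
        then show "real i * coeff (r ^ 2) i * coeff r (?t - i) = 0"
          using zero coeff_eq_0[of r] deg by auto
      qed
    qed auto
    finally show ?thesis by simp
  qed
  moreover have "coeff (r ^ 2) (2 * k) > 0" by (rule pos) simp
  moreover have "coeff r d \<noteq> 0" using coeff_high by auto
  ultimately have "real d = real k" by (simp only: mult_cancel_left mult_cancel_right) auto
  then show False using kj by simp
qed

lemma contradiction: False
proof -
  obtain m where m: "d = k * m" using eq_and_dvd(2) by (auto simp: dvd_def)
  have "k * 2 < k * m" using kj eq_and_dvd(1) by (simp flip: m)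
  moreover have "k * m \<le> k * 4" using degree_le by (simp flip: m)
  \<comment> \<open>From here on \<open>r\<close> is a polynomial in X^k of degree 3 or 4 with
    coefficients \<open>e\<close>.\<close>
  ultimately have "m = 3 \<or> m = 4" using k0 by auto
  define e where "e = (\<lambda>i. coeff r (k * i))"
  have e_zero: "e i = 0" if "m < i" for i
    using that k0 m by (simp add: e_def coeff_eq_0 deg)
  have conv: "coeff (r ^ 2) (k * t) = (\<Sum>i\<le>t. e i * e (t - i))" for t
  proof -
    have nz: "coeff r i = 0" if "\<not> k dvd i" for i
    proof (cases "i \<le> d")
      case True
      then show ?thesis using that kj eq_and_dvd(1) by (intro coeff_low) auto
    qed (simp add: coeff_eq_0 deg)
    have "coeff (r ^ 2) (k * t) = (\<Sum>i\<in>(\<lambda>i. k * i) ` {..t}. coeff r i * coeff r (k * t - i))"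
      unfolding coeff_sq
    proof (rule sum.mono_neutral_right)
      show "\<forall>i\<in>{..k * t} - (\<lambda>i. k * i) ` {..t}. coeff r i * coeff r (k * t - i) = 0"
      proof
        fix i assume i: "i \<in> {..k * t} - (\<lambda>i. k * i) ` {..t}"
        then have "\<not> k dvd i" using k0 by (auto simp: dvd_def)
        then show "coeff r i * coeff r (k * t - i) = 0" using nz by simp
      qed
    qed (use k0 in auto)
    also have "\<dots> = (\<Sum>i\<le>t. e i * e (t - i))"
      using k0 by (subst sum.reindex) (auto simp: inj_on_def e_def right_diff_distrib')
    finally show ?thesis .
  qed
  have p1: "2 * e 0 * e 1 > 0" using pos[of k] conv[of 1] by (simp add: mult.commute)
  from \<open>m = 3 \<or> m = 4\<close> show False
  proof
    \<comment> \<open>The square has exponents 0, 1, 2, 4, 5, 6 in X^k. Positivity at 1 and 5 makes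
      e 0 * e 1 * e 2 * e 3 positive, while the vanishing coefficient at 3 makes it minus a
      square.\<close>
    assume [simp]: "m = 3"
    have z: "e 4 = 0" "e 5 = 0" by (simp_all add: e_zero)
    have "coeff (r ^ 2) (k * 3) = 0" using k0 m eq_and_dvd(1) by (intro zero) auto
    then have "e 0 * e 3 + e 1 * e 2 = 0"
      using conv[of 3] by (simp add: eval_nat_numeral)
    have "coeff (r ^ 2) (k * 5) > 0" using m eq_and_dvd(1) by (intro pos) auto
    then have "e 2 * e 3 > 0"
      using conv[of 5] z by (simp add: eval_nat_numeral)
    have e03: "e 0 * e 3 = - (e 1 * e 2)"
      using \<open>e 0 * e 3 + e 1 * e 2 = 0\<close> by linarith
    have "0 < (e 0 * e 1) * (e 2 * e 3)"
      using p1 \<open>e 2 * e 3 > 0\<close> by simp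
    also have "\<dots> = (e 0 * e 3) * (e 1 * e 2)" by simp
    also have "\<dots> = - ((e 1 * e 2) * (e 1 * e 2))" by (simp only: e03 mult_minus_left)
    finally show False using zero_le_square[of "e 1 * e 2"] by linarith
  next
    \<comment> \<open>The exponents are 0, 1, 2, 6, 7, 8. Positivity at 1 and 7 with the zeros at 3
      and 5 makes e 1 * e 3 and then e 0 * e 4 positive, which the zero at 4 forbids.\<close>
    assume [simp]: "m = 4"
    have z: "e 5 = 0" "e 6 = 0" "e 7 = 0" by (simp_all add: e_zero)
    have c0: "(\<Sum>i\<le>t. e i * e (t - i)) = 0" if "t \<in> {3, 4, 5}" for t
      unfolding conv[symmetric] using that k0 m eq_and_dvd(1) by (intro zero) auto
    have *: "e 0 * e 3 + e 1 * e 2 = 0" "2 * (e 0 * e 4) + 2 * (e 1 * e 3) + e 2 * e 2 = 0"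
        "e 1 * e 4 + e 2 * e 3 = 0"
      using c0[of 3] c0[of 4] c0[of 5] z by (simp_all add: eval_nat_numeral algebra_simps)
    have "coeff (r ^ 2) (k * 7) > 0" using m eq_and_dvd(1) by (intro pos) auto
    then have "e 3 * e 4 > 0"
      using conv[of 7] z by (simp add: eval_nat_numeral algebra_simps)
    then have "0 < (e 0 * e 1) * (e 3 * e 4)" using p1 by simp
    also have "\<dots> = (e 0 * e 3) * (e 1 * e 4)" by simp
    also have "\<dots> = (e 1 * e 2) * (e 2 * e 3)"
    proof -
      have "e 0 * e 3 = - (e 1 * e 2)" "e 1 * e 4 = - (e 2 * e 3)" using *(1,3) by linarith+
      then show ?thesis by (simp only: mult_minus_left mult_minus_right minus_minus)
    qed
    also have "\<dots> = (e 1 * e 3) * (e 2 * e 2)" by simp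
    finally have e13: "0 < e 1 * e 3"
      using zero_le_square[of "e 2"] by (auto simp: zero_less_mult_iff)
    moreover have "(e 0 * e 1) * (e 3 * e 4) = (e 0 * e 4) * (e 1 * e 3)" by simp
    with \<open>0 < (e 0 * e 1) * (e 3 * e 4)\<close> have "0 < (e 0 * e 4) * (e 1 * e 3)" by (simp only:)
    ultimately have "0 < e 0 * e 4" using zero_less_mult_pos2 by blast
    then show False using *(2) e13 zero_le_square[of "e 2"] by linarith
  qed
qed

end

section \<open>Squares of exponential sums\<close>

text \<open>
  Here \<open>b x = a x * exp (x / 2)\<close> for the coefficients \<open>a\<close> of \<open>F\<close>, and \<open>h\<close> are the coefficients of \<open>H\<close>; the
  hyperbolic cosine arises by averaging the coefficients of \<open>F * G\<close> over \<open>x \<mapsto> e - x\<close>.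
\<close>

locale square_identity =
  fixes p q M :: real and b h :: "real \<Rightarrow> real" and R :: "real set"
  assumes p: "0 < p" and q: "0 < q" and pqM: "2 * p + 2 * q < M"
    and b_pos: "\<And>x. x \<in> {0, p, 2 * p, M - 2 * q, M - q, M} \<Longrightarrow> 0 < b x"
    and b_zero: "\<And>x. x \<notin> {0, p, 2 * p, M - 2 * q, M - q, M} \<Longrightarrow> b x = 0"
    and R: "finite R" and h_pos: "\<And>x. x \<in> R \<Longrightarrow> 0 < h x" and h_zero: "\<And>x. x \<notin> R \<Longrightarrow> h x = 0"
    and square: "\<And>e. (\<Sum>x\<in>{0, p, 2 * p, M - 2 * q, M - q, M}. b x * b (e - x) * cosh (x - e / 2))
      = (\<Sum>x\<in>R. h x * h (e - x))"
begin

definition L where "L = {0, p, 2 * p, M - 2 * q, M - q, M}"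

definition conv where "conv e = (\<Sum>x\<in>L. b x * b (e - x) * cosh (x - e / 2))"

lemma conv: "conv e = (\<Sum>x\<in>R. h x * h (e - x))"
  unfolding conv_def L_def by (rule square)

lemma finite_L: "finite L"
  by (simp add: L_def)

lemma bL: "x \<in> L \<Longrightarrow> 0 < b x" "x \<notin> L \<Longrightarrow> b x = 0"
  using b_pos b_zero by (auto simp: L_def)

lemma b_nonneg: "0 \<le> b x"
  using bL[of x] by (cases "x \<in> L") auto

lemma h_nonneg: "0 \<le> h x"
  using h_pos[of x] h_zero[of x] by (cases "x \<in> R") auto

text \<open>The pair occurs in both orders and no other term is negative. Bounding a coefficient by
  selected pairs is how the two sides are compared throughout.\<close>

lemma conv_ge_L:
  assumes "u \<in> L" "v \<in> L" "u \<noteq> v"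
  shows "2 * b u * b v * cosh ((u - v) / 2) \<le> conv (u + v)"
proof -
  have "(\<Sum>x\<in>{u, v}. b x * b (u + v - x) * cosh (x - (u + v) / 2)) \<le> conv (u + v)"
    unfolding conv_def using assms
    by (intro sum_mono2) (auto simp: finite_L intro!: mult_nonneg_nonneg b_nonneg less_imp_le[OF
      cosh_real_pos])
  moreover have "v - (u + v) / 2 = - ((u - v) / 2)" by (simp add: field_simps)
  moreover have "u - (u + v) / 2 = (u - v) / 2" by (simp add: field_simps)
  ultimately show ?thesis using assms by (simp add: mult_ac)
qed

lemma conv_ge_R:
  assumes "A \<subseteq> R"
  shows "(\<Sum>x\<in>A. h x * h (e - x)) \<le> conv e"
  unfolding conv using assms by (intro sum_mono2 R) (auto intro!: mult_nonneg_nonneg h_nonneg)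

lemma conv_le_R:
  assumes "\<And>z. z \<in> R \<Longrightarrow> e - z \<in> R \<Longrightarrow> z = x \<or> z = e - x" "x \<noteq> e - x"
  shows "conv e \<le> 2 * h x * h (e - x)"
proof -
  have "conv e = (\<Sum>z\<in>R \<inter> {x, e - x}. h z * h (e - z))"
    unfolding conv
  proof (rule sum.mono_neutral_right)
    show "\<forall>z\<in>R - R \<inter> {x, e - x}. h z * h (e - z) = 0" using assms(1) h_zero by fastforce
  qed (auto simp: R)
  also have "\<dots> \<le> (\<Sum>z\<in>{x, e - x}. h z * h (e - z))"
    by (rule sum_mono2) (auto intro!: mult_nonneg_nonneg h_nonneg)
  finally have "conv e \<le> (\<Sum>z\<in>{x, e - x}. h z * h (e - z))" .
  then show ?thesis using assms(2) by (simp add: mult_ac)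
qed

text \<open>Positive coefficients cannot cancel, so the sumsets R + R and L + L coincide; this is
  one inclusion, \<open>add_L\<close> the other.\<close>

lemma add_R:
  assumes "x \<in> R" "y \<in> R"
  shows "\<exists>u\<in>L. x + y - u \<in> L"
proof (rule ccontr)
  assume "\<not> ?thesis"
  then have "conv (x + y) = 0" by (auto simp: conv_def bL)
  moreover have "0 < h x * h (x + y - x)" using h_pos assms by simp
  ultimately show False using conv_ge_R[of "{x}" "x + y"] assms by simp
qed

lemma add_L:
  assumes "u \<in> L" "v \<in> L"
  shows "\<exists>x\<in>R. u + v - x \<in> R"
proof (rule ccontr)
  assume "\<not> ?thesis"
  then have "conv (u + v) = 0" by (auto simp: conv h_zero)
  moreover have "0 < b u * b (u + v - u) * cosh (u - (u + v) / 2)" using bL assms by simp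
  moreover have "b u * b (u + v - u) * cosh (u - (u + v) / 2) \<le> conv (u + v)"
    unfolding conv_def using assms
    by (intro member_le_sum) (auto simp: finite_L intro!: mult_nonneg_nonneg b_nonneg less_imp_le[OF
      cosh_real_pos])
  ultimately show False by simp
qed

lemma L_bounds: "x \<in> L \<Longrightarrow> 0 \<le> x" "x \<in> L \<Longrightarrow> x \<le> M"
  using p q pqM by (auto simp: L_def)

lemma R_nonneg:
  assumes "x \<in> R"
  shows "0 \<le> x"
proof -
  obtain u where "u \<in> L" "x + x - u \<in> L" using add_R[OF assms assms] by blast
  then show ?thesis using L_bounds(1)[of u] L_bounds(1)[of "x + x - u"] by linarith
qed

lemma zero_in_R: "0 \<in> R"
proof -
  have "0 \<in> L" by (simp add: L_def)
  from add_L[OF this this] obtain x where "x \<in> R" "- x \<in> R" by auto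
  then show ?thesis using R_nonneg[of x] R_nonneg[of "- x"] by (metis antisym neg_0_le_iff_le)
qed

text \<open>As 0 is in \<open>R\<close>, x = x + 0 is a sum of two elements of \<open>L\<close>;
  below M - 2 q both come from the lower progression.\<close>

lemma R_low: "x \<in> R \<Longrightarrow> x < M - 2 * q \<Longrightarrow> x \<in> {0, p, 2 * p, 3 * p, 4 * p}"
proof -
  assume x: "x \<in> R" "x < M - 2 * q"
  obtain u where u: "u \<in> L" "x - u \<in> L" using add_R[OF x(1) zero_in_R] by auto
  have "u \<in> {0, p, 2 * p}" using u(1) L_bounds(1)[OF u(2)] x(2) q by (auto simp: L_def)
  moreover have "x - u \<in> {0, p, 2 * p}" using u(2) L_bounds(1)[OF u(1)] x(2) q by (auto simp: L_def)
  ultimately show ?thesis by auto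
qed

text \<open>The symmetrised identity survives x -> M - x, with e replaced by 2 M - e, because cosh
  is even. Every result thus has a mirror image with \<open>p\<close> and \<open>q\<close>
  exchanged.\<close>

lemma reflect: "square_identity q p M (\<lambda>x. b (M - x)) (\<lambda>x. h (M - x)) ((-) M ` R)"
proof
  have L': "{0, q, 2 * q, M - 2 * p, M - p, M} = (-) M ` L" by (auto simp: L_def)
  show "0 < q" "0 < p" "2 * q + 2 * p < M" using p q pqM by simp_all
  show "finite ((-) M ` R)" using R by simp
  show "0 < b (M - x)" if "x \<in> {0, q, 2 * q, M - 2 * p, M - p, M}" for x
    using that bL unfolding L' by auto
  show "b (M - x) = 0" if "x \<notin> {0, q, 2 * q, M - 2 * p, M - p, M}" for x
    using that bL(2)[of "M - x"] unfolding L' by (metis diff_diff_eq2 add_diff_cancel_left' image_eqI)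
  show "0 < h (M - x)" if "x \<in> (-) M ` R" for x using that h_pos by auto
  show "h (M - x) = 0" if "x \<notin> (-) M ` R" for x
    using that h_zero[of "M - x"] by (metis diff_diff_eq2 add_diff_cancel_left' image_eqI)
  fix e
  have inj: "inj_on ((-) M) A" for A by (auto simp: inj_on_def)
  have "(\<Sum>x\<in>{0, q, 2 * q, M - 2 * p, M - p, M}. b (M - x) * b (M - (e - x)) * cosh (x - e / 2))
    = conv (2 * M - e)"
    unfolding L' conv_def sum.reindex[OF inj] comp_def
  proof (rule sum.cong[OF refl])
    fix x
    have "M - x - e / 2 = - (x - (2 * M - e) / 2)" "M - (M - x) = x" "M - (e - (M - x)) = 2 * M - e - x"
      by (simp_all add: field_simps)
    then show "b (M - (M - x)) * b (M - (e - (M - x))) * cosh (M - x - e / 2)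
        = b x * b (2 * M - e - x) * cosh (x - (2 * M - e) / 2)"
      by (simp only: cosh_minus)
  qed
  also have "\<dots> = (\<Sum>x\<in>(-) M ` R. h (M - x) * h (M - (e - x)))"
    unfolding conv by (subst sum.reindex[OF inj]) (simp add: algebra_simps)
  finally show "(\<Sum>x\<in>{0, q, 2 * q, M - 2 * p, M - p, M}. b (M - x) * b (M - (e - x)) * cosh (x - e / 2))
      = (\<Sum>x\<in>(-) M ` R. h (M - x) * h (M - (e - x)))" .
qed

lemma h_0: "h 0 = b 0"
proof -
  have "conv 0 = (\<Sum>x\<in>{0}. b x * b (0 - x) * cosh (x - 0 / 2))"
    unfolding conv_def
  proof (rule sum.mono_neutral_right)
    show "\<forall>x\<in>L - {0}. b x * b (0 - x) * cosh (x - 0 / 2) = 0"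
    proof
      fix x assume "x \<in> L - {0}"
      then have "0 - x \<notin> L" using L_bounds(1)[of x] L_bounds(1)[of "0 - x"] by auto
      then have "b (0 - x) = 0" by (rule bL(2))
      then show "b x * b (0 - x) * cosh (x - 0 / 2) = 0" by (simp only: mult_zero_right mult_zero_left)
    qed
  qed (auto simp: L_def)
  moreover have "conv 0 = (\<Sum>x\<in>{0}. h x * h (0 - x))"
    unfolding conv
  proof (rule sum.mono_neutral_right)
    show "\<forall>x\<in>R - {0}. h x * h (0 - x) = 0"
    proof
      fix x assume "x \<in> R - {0}"
      then have "0 - x \<notin> R" using R_nonneg[of x] R_nonneg[of "0 - x"] by auto
      then have "h (0 - x) = 0" by (rule h_zero)
      then show "h x * h (0 - x) = 0" by (simp only: mult_zero_right)
    qed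
  qed (auto simp: R zero_in_R)
  ultimately have "(h 0)\<^sup>2 = (b 0)\<^sup>2" by (simp add: power2_eq_square)
  then show ?thesis using h_nonneg b_nonneg by (simp add: power2_eq_iff_nonneg)
qed

text \<open>At exponent p only the pair (0, p) occurs on either side, and the values at 0
  agree.\<close>

lemma p_in_R: "p \<in> R" and h_p: "h p = b p * cosh (p / 2)"
proof -
  have zR: "z = 0 \<or> z = p" if "z \<in> R" "p - z \<in> R" for z
  proof -
    have "z \<le> p" using R_nonneg[OF that(2)] by simp
    then show ?thesis using R_low[OF that(1)] p q pqM by auto
  qed
  have "0 \<in> L" "p \<in> L" by (simp_all add: L_def)
  from add_L[OF this] obtain z where "z \<in> R" "p - z \<in> R" by auto
  then show "p \<in> R" using zR[of z] by auto
  have "conv p = (\<Sum>x\<in>{0, p}. b x * b (p - x) * cosh (x - p / 2))"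
    unfolding conv_def
  proof (rule sum.mono_neutral_right)
    show "\<forall>x\<in>L - {0, p}. b x * b (p - x) * cosh (x - p / 2) = 0"
    proof
      fix x assume "x \<in> L - {0, p}"
      then have "p - x < 0" using p q pqM by (auto simp: L_def)
      then have "p - x \<notin> L" using L_bounds(1)[of "p - x"] by auto
      then show "b x * b (p - x) * cosh (x - p / 2) = 0" by (simp add: bL)
    qed
  qed (auto simp: L_def)
  moreover have "conv p = (\<Sum>x\<in>{0, p}. h x * h (p - x))"
    unfolding conv
  proof (rule sum.mono_neutral_right)
    show "\<forall>x\<in>R - {0, p}. h x * h (p - x) = 0" using zR h_zero by fastforce
  qed (auto simp: R zero_in_R \<open>p \<in> R\<close>)
  moreover have "cosh (0 - p / 2) = cosh (p / 2)" "p - p / 2 = p / 2" by simp_all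
  ultimately have "2 * (h 0 * h p) = 2 * (b 0 * b p * cosh (p / 2))"
    using p by (simp add: mult_ac)
  then show "h p = b p * cosh (p / 2)"
    using h_0 bL(1)[OF \<open>0 \<in> L\<close>] by simp
qed

text \<open>At exponent 2 p the middle term on the right is at least that on the left, as h p = b p
  * cosh (p / 2), so the outer pair can only be smaller.\<close>

lemma h_2p_le: "h (2 * p) \<le> b (2 * p) * cosh p"
proof (cases "2 * p \<in> R")
  case False
  then show ?thesis using h_zero b_nonneg by (simp add: less_imp_le[OF cosh_real_pos])
next
  case True
  have 0: "0 \<in> L" by (simp add: L_def)
  have "conv (2 * p) = (\<Sum>x\<in>{0, p, 2 * p}. b x * b (2 * p - x) * cosh (x - 2 * p / 2))"
    unfolding conv_def
  proof (rule sum.mono_neutral_right)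
    show "\<forall>x\<in>L - {0, p, 2 * p}. b x * b (2 * p - x) * cosh (x - 2 * p / 2) = 0"
    proof
      fix x assume "x \<in> L - {0, p, 2 * p}"
      then have "2 * p - x < 0" using p q pqM by (auto simp: L_def)
      then have "2 * p - x \<notin> L" using L_bounds(1)[of "2 * p - x"] by auto
      then show "b x * b (2 * p - x) * cosh (x - 2 * p / 2) = 0" by (simp add: bL)
    qed
  qed (auto simp: L_def)
  also have "\<dots> = 2 * (b 0 * b (2 * p) * cosh p) + (b p)\<^sup>2"
    using p by (simp add: power2_eq_square mult_ac)
  finally have "conv (2 * p) = 2 * (b 0 * b (2 * p) * cosh p) + (b p)\<^sup>2" .
  moreover have "2 * (h 0 * h (2 * p)) + (h p)\<^sup>2 \<le> conv (2 * p)"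
    using conv_ge_R[of "{0, p, 2 * p}" "2 * p"] True zero_in_R p_in_R p
    by (simp add: power2_eq_square mult_ac)
  moreover have "(b p)\<^sup>2 \<le> (h p)\<^sup>2"
    using h_p b_nonneg[of p] cosh_real_ge_1[of "p / 2"]
      by (intro power_mono) (auto simp: mult_le_cancel_left1)
  ultimately have "b 0 * h (2 * p) \<le> b 0 * (b (2 * p) * cosh p)" by (simp add: h_0 mult_ac)
  then show ?thesis using bL(1)[OF 0] by simp
qed

lemma h_M: "h M = b M" and h_Mq: "h (M - q) = b (M - q) * cosh (q / 2)"
  and h_M2q_le: "h (M - 2 * q) \<le> b (M - 2 * q) * cosh q"
  and R_high: "x \<in> R \<Longrightarrow> 2 * p < x \<Longrightarrow> x \<in> {M, M - q, M - 2 * q, M - 3 * q, M - 4 * q}"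
proof -
  interpret R: square_identity q p M "\<lambda>x. b (M - x)" "\<lambda>x. h (M - x)" "(-) M ` R" by (rule reflect)
  show "h M = b M" using R.h_0 by simp
  show "h (M - q) = b (M - q) * cosh (q / 2)" using R.h_p by simp
  show "h (M - 2 * q) \<le> b (M - 2 * q) * cosh q" using R.h_2p_le by simp
  show "x \<in> {M, M - q, M - 2 * q, M - 3 * q, M - 4 * q}" if "x \<in> R" "2 * p < x" for x
    using R.R_low[of "M - x"] that by (auto simp: algebra_simps)
qed

text \<open>A point strictly between the two progressions satisfies both the low and the high
  description; this third alternative is itself a relation M = k p + j q.\<close>

lemma R_cases:
  assumes "x \<in> R"
  shows "(\<exists>i\<le>2. x = of_nat i * p) \<or> (\<exists>j\<le>2. x = M - of_nat j * q) \<or>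
    (\<exists>k j. 0 < k \<and> 0 < j \<and> x = of_nat k * p \<and> x = M - of_nat j * q)"
proof -
  consider "x \<le> 2 * p" | "2 * p < x" "x < M - 2 * q" | "M - 2 * q \<le> x" by linarith
  then show ?thesis
  proof cases
    case 1
    then have "x \<in> {0, p, 2 * p}" using R_low[OF assms] p q pqM by auto
    then have "\<exists>i\<le>2. x = of_nat i * p"
      by (auto simp: numeral_2_eq_2 le_Suc_eq conj_disj_distribR ex_disj_distrib)
    then show ?thesis by blast
  next
    case 2
    then have "x = of_nat 3 * p \<or> x = of_nat 4 * p" using R_low[OF assms] p by auto
    moreover have "x = M - of_nat 3 * q \<or> x = M - of_nat 4 * q" using R_high[OF assms] 2 q by auto
    ultimately show ?thesis by (metis zero_less_numeral)
  next
    case 3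
    then have "x \<in> {M - 2 * q, M - q, M}" using R_high[OF assms] p q pqM by auto
    then have "\<exists>j\<le>2. x = M - of_nat j * q"
      by (auto simp: numeral_2_eq_2 le_Suc_eq conj_disj_distribR ex_disj_distrib)
    then show ?thesis by blast
  qed
qed


text \<open>
  At the exponent \<open>M\<close> the pair \<open>(0, M)\<close> contributes more on the left than on the right, so a further
  pair in \<open>R\<close> has sum \<open>M\<close>.
\<close>

lemma some_ratio_rational: "p / q \<in> \<rat> \<or> M / p \<in> \<rat> \<or> M / q \<in> \<rat>"
proof -
  have "\<exists>z\<in>R. M - z \<in> R \<and> z \<noteq> 0 \<and> z \<noteq> M"
  proof (rule ccontr)
    assume "\<not> ?thesis"
    then have "conv M \<le> 2 * h 0 * h (M - 0)"
      using p q pqM by (intro conv_le_R) auto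
    moreover have "2 * b 0 * b M * cosh ((0 - M) / 2) \<le> conv (0 + M)"
      using p q pqM by (intro conv_ge_L) (auto simp: L_def)
    moreover have "0 < b 0 * b M" using bL(1) by (simp add: L_def)
    moreover have "1 < cosh ((0 - M) / 2)"
      using p q pqM cosh_real_strict_mono[of 0 "M / 2"] by simp
    ultimately show False
      using mult_strict_left_mono[of 1 "cosh ((0 - M) / 2)" "b 0 * b M"] by (simp add: h_0 h_M)
  qed
  then obtain z where z: "z \<in> R" "M - z \<in> R" "z \<noteq> 0" "z \<noteq> M" by blast
  have lohi: "(\<exists>i::nat. x = of_nat i * p) \<or> (\<exists>j::nat. x = M - of_nat j * q)" if "x \<in> R" for x
    using R_cases[OF that] by blast
  \<comment> \<open>Two low or two high summands make M an integral multiple of p or q. The mixed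
    cases read i p = j q and are nontrivial because z is neither 0 nor M.\<close>
  from lohi[OF z(1)] lohi[OF z(2)] consider
      i j :: nat where "z = of_nat i * p" "M - z = of_nat j * p"
    | i j :: nat where "z = of_nat i * p" "M - z = M - of_nat j * q"
    | i j :: nat where "z = M - of_nat i * q" "M - z = of_nat j * p"
    | i j :: nat where "z = M - of_nat i * q" "M - z = M - of_nat j * q"
    by blast
  then show ?thesis
  proof cases
    case 1
    then have "M / p = of_nat (i + j)" using p by (simp add: field_simps)
    then show ?thesis by simp
  next
    case 2
    then have "p / q = of_nat j / of_nat i" using z(3) q by (auto simp: field_simps)
    then show ?thesis by simp
  next
    case 3
    then have "j \<noteq> 0" using z(4) by auto
    then have "p / q = of_nat i / of_nat j" using 3 q by (simp add: field_simps)
    then show ?thesis by simp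
  next
    case 4
    then have "M / q = of_nat (i + j)" using q by (simp add: field_simps)
    then show ?thesis by simp
  qed
qed

text \<open>Here \<open>(0, M - 2 * q)\<close> is the only pair in \<open>R\<close> with sum \<open>M - 2 * q\<close>.\<close>

lemma M_le_4q:
  assumes pq: "p / q \<in> \<rat>" and Mp: "M / p \<notin> \<rat>"
  shows "M \<le> 4 * q"
proof -
  have Mq: "M / q \<notin> \<rat>"
    using Rats_divide[of "M / q" "p / q"] pq Mp q by auto
  have not: "M \<noteq> of_nat i * p + of_nat j * q" for i j
  proof
    assume "M = of_nat i * p + of_nat j * q"
    then have "M / q = of_nat i * (p / q) + of_nat j" using q by (simp add: field_simps)
    also have "\<dots> \<in> \<rat>" using pq by (intro Rats_add Rats_mult Rats_of_nat)
    finally show False using Mq by simp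
  qed
  have cases: "(\<exists>i\<le>2. x = of_nat i * p) \<or> (\<exists>j\<le>2. x = M - of_nat j * q)" if "x \<in> R" for x
    using R_cases[OF that] not by (metis diff_eq_eq)
  let ?e = "M - 2 * q"
  have uniq: "z = 0 \<or> z = ?e - 0" if z: "z \<in> R" "?e - z \<in> R" for z
  proof -
    from cases[OF z(1)] cases[OF z(2)] consider
        i j :: nat where "z = of_nat i * p" "?e - z = of_nat j * p"
      | i j :: nat where "j \<le> 2" "z = of_nat i * p" "?e - z = M - of_nat j * q"
      | i j :: nat where "i \<le> 2" "z = M - of_nat i * q" "?e - z = of_nat j * p"
      | i j :: nat where "z = M - of_nat i * q" "?e - z = M - of_nat j * q"
      by blast
    then show ?thesis
    proof cases
      case 1
      then have "M = of_nat (i + j) * p + of_nat 2 * q" by (simp add: algebra_simps)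
      then show ?thesis using not by blast
    next
      case 2
      then have "of_nat i * p = (of_nat j - 2) * q" by (simp add: algebra_simps)
      also have "\<dots> \<le> 0" using 2(1) q by (simp add: mult_nonpos_nonneg)
      finally show ?thesis using p 2(2) by (simp add: mult_le_0_iff)
    next
      case 3
      then have "of_nat j * p = (of_nat i - 2) * q" by (simp add: algebra_simps)
      also have "\<dots> \<le> 0" using 3(1) q by (simp add: mult_nonpos_nonneg)
      finally show ?thesis using p 3(3) by (simp add: mult_le_0_iff)
    next
      case 4
      then have "M + of_nat 2 * q = of_nat 0 * p + of_nat (i + j) * q" by (simp add: algebra_simps)
      then have "M / q = of_nat (i + j) - 2" using q by (simp add: field_simps)
      then show ?thesis using Mq by simp
    qed
  qed
  \<comment> \<open>The pair (0, ?e) enters the left side with the factor cosh (?e / 2), whereas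
    \<open>h_M2q_le\<close> admits at most cosh q on the right; hence M - 2 q <= 2 q.\<close>
  have "conv ?e \<le> 2 * h 0 * h (?e - 0)"
    using p q pqM by (intro conv_le_R uniq) auto
  moreover have "2 * b 0 * b ?e * cosh ((0 - ?e) / 2) \<le> conv (0 + ?e)"
    using p q pqM by (intro conv_ge_L) (auto simp: L_def)
  ultimately have "b 0 * (b ?e * cosh ((0 - ?e) / 2)) \<le> b 0 * h ?e" by (simp add: h_0)
  then have "b ?e * cosh ((0 - ?e) / 2) \<le> h ?e" using bL(1)[of 0] by (simp add: L_def)
  also have "\<dots> \<le> b ?e * cosh q" by (rule h_M2q_le)
  finally have "cosh ((0 - ?e) / 2) \<le> cosh q" using bL(1)[of ?e] by (simp add: L_def)
  moreover have "cosh ((0 - ?e) / 2) = cosh (?e / 2)" by (metis cosh_minus diff_0 minus_divide_left)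
  ultimately have "cosh (?e / 2) \<le> cosh q" by (simp only:)
  then have "?e / 2 \<le> q" using p q pqM by (subst (asm) cosh_real_nonneg_le_iff) auto
  then show ?thesis by simp
qed

text \<open>Were \<open>p / q\<close> irrational, \<open>(0, M - q)\<close> would be the only pair in \<open>R\<close> with sum \<open>M - q\<close>.\<close>

lemma p_over_q_rational_if:
  assumes Mp: "M / p \<in> \<rat>"
  shows "p / q \<in> \<rat>"
proof (rule ccontr)
  assume pq: "p / q \<notin> \<rat>"
  have qp: "q / p \<notin> \<rat>" using pq Rats_inverse[of "q / p"] by auto
  have Mq: "M / q \<notin> \<rat>"
    using Rats_divide[of "M / q" "M / p"] pq Mp p q pqM by auto
  have not: "real i * p = c * q \<Longrightarrow> c \<in> \<rat> \<Longrightarrow> c = 0 \<and> i = 0" for i c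
  proof -
    assume *: "real i * p = c * q" "c \<in> \<rat>"
    show "c = 0 \<and> i = 0"
    proof (cases "i = 0")
      case False
      then have "p / q = c / real i" using * q by (simp add: field_simps)
      then show ?thesis using pq * by simp
    qed (use * q in auto)
  qed
  have notM: "M \<noteq> of_nat i * p + c * q" if "c \<in> \<rat>" "c \<noteq> 0" for i c
  proof
    assume "M = of_nat i * p + c * q"
    then have "q / p = (M / p - of_nat i) / c" using p that by (simp add: field_simps)
    then show False using qp Mp that by simp
  qed
  have cases: "(\<exists>i. x = of_nat i * p) \<or> (\<exists>j. x = M - of_nat j * q)" if "x \<in> R" for x
    using R_cases[OF that] by blast
  let ?e = "M - q"
  have uniq: "z = 0 \<or> z = ?e - 0" if z: "z \<in> R" "?e - z \<in> R" for z
  proof -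
    from cases[OF z(1)] cases[OF z(2)] consider
        i j :: nat where "z = of_nat i * p" "?e - z = of_nat j * p"
      | i j :: nat where "z = of_nat i * p" "?e - z = M - of_nat j * q"
      | i j :: nat where "z = M - of_nat i * q" "?e - z = of_nat j * p"
      | i j :: nat where "z = M - of_nat i * q" "?e - z = M - of_nat j * q"
      by blast
    then show ?thesis
    proof cases
      case 1
      then have "M = of_nat (i + j) * p + 1 * q" by (simp add: algebra_simps)
      then show ?thesis using notM[of 1] by fastforce
    next
      case 2
      then have "of_nat i * p = (of_nat j - 1) * q" by (simp add: algebra_simps)
      then show ?thesis using not[of i "of_nat j - 1"] 2 by simp
    next
      case 3
      then have "of_nat j * p = (of_nat i - 1) * q" by (simp add: algebra_simps)
      then show ?thesis using not[of j "of_nat i - 1"] 3 by simp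
    next
      case 4
      then have "M / q = of_nat (i + j) - 1" using q by (simp add: field_simps)
      then show ?thesis using Mq by simp
    qed
  qed
  have "conv ?e \<le> 2 * h 0 * h (?e - 0)"
    using p q pqM by (intro conv_le_R uniq) auto
  moreover have "2 * b 0 * b ?e * cosh ((0 - ?e) / 2) \<le> conv (0 + ?e)"
    using p q pqM by (intro conv_ge_L) (auto simp: L_def)
  ultimately have "b 0 * (b ?e * cosh ((0 - ?e) / 2)) \<le> b 0 * (b ?e * cosh (q / 2))"
    by (simp add: h_0 h_Mq)
  then have "cosh ((0 - ?e) / 2) \<le> cosh (q / 2)" using bL(1)[of 0] bL(1)[of ?e] by (simp add: L_def)
  moreover have "cosh ((0 - ?e) / 2) = cosh (?e / 2)" by (metis cosh_minus diff_0 minus_divide_left)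
  ultimately have "cosh (?e / 2) \<le> cosh (q / 2)" by (simp only:)
  then have "?e / 2 \<le> q / 2" using p q pqM by (subst (asm) cosh_real_nonneg_le_iff) auto
  then show False using p pqM by simp
qed

text \<open>Any rational ratio forces p / q to be rational, by reflection if need be. Were M / p
  irrational, then M <= 4 q and its mirror image M <= 4 p would add up to a contradiction with 2 p +
  2 q < M.\<close>

lemma ratios_rational: "p / q \<in> \<rat>" "M / p \<in> \<rat>"
proof -
  interpret R: square_identity q p M "\<lambda>x. b (M - x)" "\<lambda>x. h (M - x)" "(-) M ` R" by (rule reflect)
  show pq: "p / q \<in> \<rat>"
    using some_ratio_rational p_over_q_rational_if R.p_over_q_rational_if Rats_inverse[of "q / p"] by
      auto
  show "M / p \<in> \<rat>"
  proof (rule ccontr)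
    assume Mp: "M / p \<notin> \<rat>"
    then have "M / q \<notin> \<rat>"
      using Rats_divide[of "M / q" "p / q"] pq q by auto
    moreover have "q / p \<in> \<rat>" using pq Rats_inverse[of "p / q"] by simp
    ultimately have "M \<le> 4 * p" using R.M_le_4q by blast
    moreover have "M \<le> 4 * q" using M_le_4q pq Mp by blast
    ultimately show False using pqM by linarith
  qed
qed

lemma common_unit:
  "\<exists>\<theta> k j n. 0 < \<theta> \<and> p = of_nat k * \<theta> \<and> q = of_nat j * \<theta> \<and> M = of_nat n * \<theta> \<and>
    (\<forall>x\<in>R. \<exists>i. x = of_nat i * \<theta>)"
proof -
  have pos: "\<exists>m n. 0 < m \<and> 0 < n \<and> x = real m / real n" if "x \<in> \<rat>" "0 < x" for x :: real
    using Rats_abs_nat_div_natE[OF that(1)] that(2)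
      by (metis abs_of_pos divide_eq_0_iff gr0I of_nat_0 less_irrefl)
  obtain k j where kj: "0 < k" "0 < j" "p / q = real k / real j"
    using pos[OF ratios_rational(1)] p q by auto
  obtain n m where nm: "0 < n" "0 < m" "M / p = real n / real m"
    using pos[OF ratios_rational(2)] p q pqM by auto
  define \<theta> where "\<theta> = p / (real k * real m)"
  have \<theta>: "0 < \<theta>" using p kj nm by (simp add: \<theta>_def)
  have p': "p = of_nat (k * m) * \<theta>" using kj nm by (simp add: \<theta>_def)
  have q': "q = of_nat (j * m) * \<theta>" using kj nm p q by (simp add: \<theta>_def field_simps)
  have M': "M = of_nat (n * k) * \<theta>" using kj nm p by (simp add: \<theta>_def field_simps)
  have "\<exists>i. x = of_nat i * \<theta>" if x: "x \<in> R" for x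
  proof -
    from R_cases[OF x] consider i :: nat where "x = of_nat i * p" | i :: nat where "x
      = M - of_nat i * q" by blast
    then show ?thesis
    proof cases
      case 1
      then have "x = of_nat (i * (k * m)) * \<theta>" using p' by simp
      then show ?thesis by blast
    next
      case 2
      then have x': "x = (of_nat (n * k) - of_nat (i * (j * m))) * \<theta>" using q' M'
        by (simp add: algebra_simps)
      then have "of_nat (i * (j * m)) \<le> (of_nat (n * k) :: real)"
        using R_nonneg[OF x] \<theta> by (simp add: zero_le_mult_iff)
      then have "i * (j * m) \<le> n * k" by (simp only: of_nat_le_iff)
      then have "x = of_nat (n * k - i * (j * m)) * \<theta>" using x' by (simp only: of_nat_diff)
      then show ?thesis by blast
    qed
  qed
  then have all: "\<forall>x\<in>R. \<exists>i. x = of_nat i * \<theta>" ..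
  show ?thesis
    by (intro exI, intro conjI, rule \<theta>, rule p', rule q', rule M', rule all)
qed

end

section \<open>Exponential sums as convolutions and as polynomials\<close>

lemma poly_eqI_on_powers:
  fixes f g :: "real poly"
  assumes \<tau>: "1 < \<tau>" and eq: "\<And>n. poly f (\<tau> ^ n) = poly g (\<tau> ^ n)"
  shows "f = g"
proof (rule ccontr)
  assume "f \<noteq> g"
  then have "finite {x. poly (f - g) x = 0}" by (intro poly_roots_finite) simp
  moreover have "range (\<lambda>n. \<tau> ^ n) \<subseteq> {x. poly (f - g) x = 0}" using eq by auto
  moreover have "inj (\<lambda>n::nat. \<tau> ^ n)" using \<tau> by (auto intro!: injI simp: power_inject_exp)
  ultimately show False using finite_subset range_inj_infinite by blast
qed

text \<open>\<open>E\<close> may be any finite set containing all sums, so that two products can be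
  compared over one index set.\<close>

lemma exp_sum_mult:
  fixes f g :: "real \<Rightarrow> real"
  assumes fin: "finite X" "finite Y" "finite E"
    and E: "\<And>x y. x \<in> X \<Longrightarrow> y \<in> Y \<Longrightarrow> x + y \<in> E" and g: "\<And>y. y \<notin> Y \<Longrightarrow> g y = 0"
  shows "(\<Sum>x\<in>X. f x * exp x ^ n) * (\<Sum>y\<in>Y. g y * exp y ^ n)
    = (\<Sum>e\<in>E. (\<Sum>x\<in>X. f x * g (e - x)) * exp e ^ n)"
proof -
  have "(\<Sum>y\<in>Y. f x * g y * exp (x + y) ^ n) = (\<Sum>e\<in>E. f x * g (e - x) * exp e ^ n)" if "x \<in> X" for x
  proof -
    have "(\<Sum>y\<in>Y. f x * g y * exp (x + y) ^ n) = (\<Sum>e\<in>(+) x ` Y. f x * g (e - x) * exp e ^ n)"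
      by (subst sum.reindex) auto
    also have "\<dots> = (\<Sum>e\<in>E. f x * g (e - x) * exp e ^ n)"
    proof (rule sum.mono_neutral_left)
      show "\<forall>e\<in>E - (+) x ` Y. f x * g (e - x) * exp e ^ n = 0"
      proof
        fix e assume "e \<in> E - (+) x ` Y"
        then have "e - x \<notin> Y" by (metis DiffD2 add.commute diff_add_cancel image_eqI)
        then show "f x * g (e - x) * exp e ^ n = 0" by (simp add: g)
      qed
    qed (use fin E that in auto)
    finally show ?thesis .
  qed
  then have "(\<Sum>x\<in>X. \<Sum>y\<in>Y. f x * g y * exp (x + y) ^ n) = (\<Sum>e\<in>E. \<Sum>x\<in>X. f x * g (e - x) * exp e ^ n)"
    by (subst (2) sum.swap) simp
  moreover have "(\<Sum>x\<in>X. f x * exp x ^ n) * (\<Sum>y\<in>Y. g y * exp y ^ n)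
    = (\<Sum>x\<in>X. \<Sum>y\<in>Y. f x * g y * exp (x + y) ^ n)"
    unfolding sum_product by (simp add: exp_add power_mult_distrib mult_ac)
  ultimately show ?thesis by (simp only: sum_distrib_right)
qed

lemma exp_sum_square_coefficients:
  fixes a h :: "real \<Rightarrow> real"
  assumes fin: "finite L" "finite R"
    and zero: "\<And>x. x \<notin> L \<Longrightarrow> a x = 0" "\<And>x. x \<notin> R \<Longrightarrow> h x = 0"
    and eq: "\<And>n. (\<Sum>x\<in>L. a x * exp x ^ n) * (\<Sum>x\<in>L. a x * exp x ^ Suc n) = (\<Sum>x\<in>R. h x * exp x ^ n)\<^sup>2"
  shows "(\<Sum>x\<in>L. a x * a (e - x) * exp (e - x)) = (\<Sum>x\<in>R. h x * h (e - x))"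
proof -
  \<comment> \<open>Inserting \<open>e\<close> covers exponents outside both sumsets, so the
    identity holds for every real \<open>e\<close>.\<close>
  define E where "E = insert e ((\<lambda>(x, y). x + y) ` (L \<times> L) \<union> (\<lambda>(x, y). x + y) ` (R \<times> R))"
  have E: "finite E" "e \<in> E" using fin by (auto simp: E_def)
  have EL: "x + y \<in> E" if "x \<in> L" "y \<in> L" for x y using that by (force simp: E_def)
  have ER: "x + y \<in> E" if "x \<in> R" "y \<in> R" for x y using that by (force simp: E_def)
  define c where "c e = (\<Sum>x\<in>L. a x * (a (e - x) * exp (e - x))) - (\<Sum>x\<in>R. h x * h (e - x))" for e
  have "(\<Sum>z\<in>exp ` E. c (ln z) * z ^ n) = 0" for n
  proof -
    have "(\<Sum>x\<in>L. a x * exp x ^ n) * (\<Sum>y\<in>L. (a y * exp y) * exp y ^ n)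
      = (\<Sum>e\<in>E. (\<Sum>x\<in>L. a x * (a (e - x) * exp (e - x))) * exp e ^ n)"
      using fin E EL zero by (intro exp_sum_mult) auto
    moreover have "(\<Sum>x\<in>R. h x * exp x ^ n) * (\<Sum>x\<in>R. h x * exp x ^ n)
      = (\<Sum>e\<in>E. (\<Sum>x\<in>R. h x * h (e - x)) * exp e ^ n)"
      using fin E ER zero by (intro exp_sum_mult) auto
    ultimately have "(\<Sum>e\<in>E. c e * exp e ^ n) = 0"
      using eq[of n] by (simp add: c_def left_diff_distrib sum_subtractf power2_eq_square mult.assoc)
    then show ?thesis by (subst sum.reindex) (auto intro: inj_onI)
  qed
  then have "c (ln (exp e)) = 0" using E by (intro power_sums_independent[of "exp ` E"
    "\<lambda>z. c (ln z)"]) auto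
  then show ?thesis by (simp add: c_def mult.assoc)
qed

lemma exp_sum_square_cosh:
  fixes a h :: "real \<Rightarrow> real"
  assumes fin: "finite L" "finite R"
    and zero: "\<And>x. x \<notin> L \<Longrightarrow> a x = 0" "\<And>x. x \<notin> R \<Longrightarrow> h x = 0"
    and eq: "\<And>n. (\<Sum>x\<in>L. a x * exp x ^ n) * (\<Sum>x\<in>L. a x * exp x ^ Suc n) = (\<Sum>x\<in>R. h x * exp x ^ n)\<^sup>2"
    and b: "\<And>x. b x = a x * exp (x / 2)"
  shows "(\<Sum>x\<in>L. b x * b (e - x) * cosh (x - e / 2)) = (\<Sum>x\<in>R. h x * h (e - x))"
proof -
  \<comment> \<open>On this set x -> e - x is an involution; \<open>L\<close> itself need not be
    invariant.\<close>
  let ?L = "{x \<in> L. e - x \<in> L}"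
  have restrict: "(\<Sum>x\<in>L. b x * b (e - x) * g x) = (\<Sum>x\<in>?L. b x * b (e - x) * g x)" for g
    using fin zero by (intro sum.mono_neutral_right) (auto simp: b)
  have "b x * b (e - x) * exp (e / 2 - x) = a x * a (e - x) * exp (e - x)" for x
  proof -
    have "exp (x / 2) * exp ((e - x) / 2) * exp (e / 2 - x) = exp (e - x)"
      unfolding exp_add[symmetric] by (rule arg_cong[of _ _ exp]) (simp add: field_simps)
    then show ?thesis by (simp add: b mult_ac)
  qed
  then have 1: "(\<Sum>x\<in>L. b x * b (e - x) * exp (e / 2 - x)) = (\<Sum>x\<in>R. h x * h (e - x))"
    using exp_sum_square_coefficients[OF fin zero eq] by simp
  have "(\<Sum>x\<in>?L. b x * b (e - x) * exp (x - e / 2)) = (\<Sum>x\<in>?L. b x * b (e - x) * exp (e / 2 - x))"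
    by (rule sum.reindex_bij_witness[of _ "\<lambda>x. e - x" "\<lambda>x. e - x"]) (auto simp: field_simps)
  then have 2: "(\<Sum>x\<in>L. b x * b (e - x) * exp (x - e / 2)) = (\<Sum>x\<in>R. h x * h (e - x))"
    using 1 by (simp add: restrict)
  have "(\<Sum>x\<in>L. b x * b (e - x) * cosh (x - e / 2))
      = (\<Sum>x\<in>L. (b x * b (e - x) * exp (x - e / 2) + b x * b (e - x) * exp (e / 2 - x)) / 2)"
    by (intro sum.cong refl) (simp add: cosh_field_def algebra_simps)
  then show ?thesis by (simp only: sum_divide_distrib[symmetric] sum.distrib 1 2) simp
qed

lemma no_exponential_square:
  fixes a h :: "real \<Rightarrow> real" and p q M :: real
  defines "X \<equiv> {0, p, 2 * p, M - 2 * q, M - q, M}"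
  assumes gap: "0 < p" "0 < q" "2 * p + 2 * q < M"
    and a: "\<And>x. x \<in> X \<Longrightarrow> 0 < a x" "\<And>x. x \<notin> X \<Longrightarrow> a x = 0"
    and h: "finite R" "\<And>x. x \<in> R \<Longrightarrow> 0 < h x" "\<And>x. x \<notin> R \<Longrightarrow> h x = 0"
    and eq: "\<And>n. (\<Sum>x\<in>X. a x * exp x ^ n) * (\<Sum>x\<in>X. a x * exp x ^ Suc n) = (\<Sum>x\<in>R. h x * exp x ^ n)\<^sup>2"
  shows False
proof -
  have finX: "finite X" by (simp add: X_def)
  define b where "b x = a x * exp (x / 2)" for x
  interpret square_identity p q M b h R
  proof
    show "0 < b x" if "x \<in> {0, p, 2 * p, M - 2 * q, M - q, M}" for x
      using that a(1) by (simp add: b_def flip: X_def)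
    show "b x = 0" if "x \<notin> {0, p, 2 * p, M - 2 * q, M - q, M}" for x
      using that a(2) by (simp add: b_def flip: X_def)
    show "(\<Sum>x\<in>{0, p, 2 * p, M - 2 * q, M - q, M}. b x * b (e - x) * cosh (x - e / 2))
      = (\<Sum>x\<in>R. h x * h (e - x))" for e
      unfolding X_def[symmetric] by (rule exp_sum_square_cosh[OF finX h(1) a(2) h(3) eq b_def])
  qed (use gap h in auto)
  obtain \<theta> k j n where \<theta>: "0 < \<theta>" and unit: "p = of_nat k * \<theta>" "q = of_nat j * \<theta>" "M = of_nat n * \<theta>"
    and R\<theta>: "\<forall>x\<in>R. \<exists>i. x = of_nat i * \<theta>"
    using common_unit by blast
  have kj: "0 < k" "0 < j" using gap(1,2) \<theta> unit by (auto intro: gr0I)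
  have "(2 * of_nat k + 2 * of_nat j) * \<theta> < of_nat n * \<theta>" using gap(3) unit by (simp add: algebra_simps)
  then have "2 * of_nat k + 2 * of_nat j < (of_nat n :: real)" using \<theta> by simp
  then have kjn: "2 * k + 2 * j < n" by linarith
  let ?L = "{0, k, 2 * k, n - 2 * j, n - j, n}"
  have X_img: "X = (\<lambda>i. of_nat i * \<theta>) ` ?L"
    using kjn by (simp add: X_def unit of_nat_diff algebra_simps)
  have inj: "inj_on (\<lambda>i::nat. of_nat i * \<theta>) A" for A
    using \<theta> by (auto simp: inj_on_def)
  obtain I where R_img: "R = (\<lambda>i::nat. of_nat i * \<theta>) ` I"
    using R\<theta> by (metis (mono_tags, lifting) image_subsetI subset_image_iff subsetI rangeI)
  have I: "finite I" using h(1) inj R_img by (metis finite_image_iff)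
  \<comment> \<open>The sums become values of \<open>F\<close> and \<open>H\<close> at powers of
    this base, and passing from m to m + 1 is the substitution Y -> tau Y.\<close>
  define \<tau> where "\<tau> = exp \<theta>"
  have \<tau>: "1 < \<tau>" using \<theta> by (simp add: \<tau>_def)
  define F where "F = (\<Sum>i\<in>?L. monom (a (of_nat i * \<theta>)) i)"
  define H where "H = (\<Sum>i\<in>I. monom (h (of_nat i * \<theta>)) i)"
  have pow: "exp (of_nat i * \<theta>) ^ m = (\<tau> ^ m) ^ i" for i m :: nat
    by (simp add: \<tau>_def mult.commute flip: exp_of_nat_mult)
  have F: "poly F (\<tau> ^ m) = (\<Sum>x\<in>X. a x * exp x ^ m)" for m
    unfolding F_def X_img sum.reindex[OF inj] comp_def pow by (simp only: poly_sum poly_monom)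
  have H: "poly H (\<tau> ^ m) = (\<Sum>x\<in>R. h x * exp x ^ m)" for m
    unfolding H_def R_img sum.reindex[OF inj] comp_def pow by (simp only: poly_sum poly_monom)
  have "F * (F \<circ>\<^sub>p [:0, \<tau>:]) = H ^ 2"
  proof (rule poly_eqI_on_powers[OF \<tau>])
    fix m
    have "poly (F \<circ>\<^sub>p [:0, \<tau>:]) (\<tau> ^ m) = poly F (\<tau> ^ Suc m)" by (simp add: poly_pcompose mult.commute)
    then show "poly (F * (F \<circ>\<^sub>p [:0, \<tau>:])) (\<tau> ^ m) = poly (H ^ 2) (\<tau> ^ m)"
      using eq[of m] by (simp only: poly_mult poly_power F H)
  qed
  moreover have coeff_F: "coeff F i = (if i \<in> ?L then a (of_nat i * \<theta>) else 0)" for i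
    unfolding F_def coeff_sum coeff_monom by (subst sum.delta) auto
  have pos: "0 < coeff F i" if "i \<in> ?L" for i
    using that a(1)[of "of_nat i * \<theta>"] X_img by (simp only: coeff_F if_True) blast
  ultimately obtain r where r: "F = r ^ 2"
    using real_poly_square_if_scaled_product_square[OF \<tau>] pos[of 0] by blast
  have "degree F = n"
  proof (rule antisym)
    show "degree F \<le> n" using kjn by (intro degree_le) (auto simp: coeff_F)
    show "n \<le> degree F" using pos[of n] by (intro le_degree) auto
  qed
  moreover have "r \<noteq> 0" using r pos[of 0] by auto
  ultimately have n: "n = 2 * degree r" using r by (simp add: degree_power_eq)
  have "sparse_square r k j (degree r)"
  proof
    show "k + j < degree r" using kjn n by simp
    show "0 < coeff (r ^ 2) i"
      if "i \<in> {0, k, 2 * k, 2 * degree r - 2 * j, 2 * degree r - j, 2 * degree r}" for i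
      using pos[of i] that unfolding r[symmetric] n[symmetric] by blast
    show "coeff (r ^ 2) i = 0"
      if "i \<notin> {0, k, 2 * k, 2 * degree r - 2 * j, 2 * degree r - j, 2 * degree r}" for i
      using that unfolding r[symmetric] n[symmetric] coeff_F by (rule if_not_P)
  qed (use kj in auto)
  then show False by (rule sparse_square.contradiction)
qed

text \<open>After merging equal values of \<open>f\<close>, the coefficient at \<open>f z\<close> is
  a positive sum, which independence of power sums lets only a base in \<open>S\<close> match. It
  locates products of two atoms of \<open>\<beta>\<close> among products of two atoms of the
  measure.\<close>

lemma bases_of_positive_power_sum:
  fixes f :: "'a \<Rightarrow> real" and d :: "real \<Rightarrow> real"
  assumes fin: "finite Z" "finite S" and c: "\<And>z. z \<in> Z \<Longrightarrow> 0 < c z"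
    and eq: "\<And>n. (\<Sum>z\<in>Z. c z * f z ^ n) = (\<Sum>e\<in>S. d e * e ^ n)" and z: "z \<in> Z"
  shows "f z \<in> S"
proof (rule ccontr)
  assume nS: "f z \<notin> S"
  let ?T = "f ` Z \<union> S"
  define C where "C e = (\<Sum>z\<in>{z\<in>Z. f z = e}. c z) - (if e \<in> S then d e else 0)" for e
  have "(\<Sum>e\<in>?T. C e * e ^ n) = 0" for n
  proof -
    have "(\<Sum>z\<in>Z. c z * f z ^ n) = (\<Sum>e\<in>?T. \<Sum>z\<in>{z\<in>Z. f z = e}. c z * f z ^ n)"
      by (rule sum.group[symmetric]) (use fin in auto)
    also have "\<dots> = (\<Sum>e\<in>?T. (\<Sum>z\<in>{z\<in>Z. f z = e}. c z) * e ^ n)"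
      by (intro sum.cong refl) (simp add: sum_distrib_right)
    finally have 1: "(\<Sum>z\<in>Z. c z * f z ^ n) = (\<Sum>e\<in>?T. (\<Sum>z\<in>{z\<in>Z. f z = e}. c z) * e ^ n)" .
    have 2: "(\<Sum>e\<in>S. d e * e ^ n) = (\<Sum>e\<in>?T. (if e \<in> S then d e else 0) * e ^ n)"
      using fin by (intro sum.mono_neutral_cong_left) auto
    show ?thesis using eq[of n] unfolding 1 2 C_def by (simp add: left_diff_distrib sum_subtractf)
  qed
  then have "C (f z) = 0" using fin z by (intro power_sums_independent[of ?T C]) auto
  moreover have "0 < (\<Sum>y\<in>{y\<in>Z. f y = f z}. c y)"
    using fin z c by (intro sum_pos) auto
  ultimately show False using nS by (simp add: C_def)
qed

section \<open>Moments of measures with finitely many atoms\<close>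

lemma integral_point_masses:
  fixes f :: "real \<Rightarrow> real"
  assumes fm: "finite_measure \<mu>" and sets: "sets \<mu> = sets borel"
    and emeasure: "\<And>A. A \<in> sets borel \<Longrightarrow>
      emeasure \<mu> A = (\<Sum>i\<in>I. ennreal (a i) * emeasure (return borel (lam i)) A)"
    and I: "finite I" "inj_on lam I" and a: "\<And>i. i \<in> I \<Longrightarrow> 0 \<le> a i"
    and f: "f \<in> borel_measurable borel"
  shows "(LINT t|\<mu>. f t) = (\<Sum>i\<in>I. a i * f (lam i))"
proof -
  interpret finite_measure \<mu> by (rule fm)
  have [measurable_cong]: "sets \<mu> = sets borel" by (rule sets)
  note f [measurable]
  have fin: "finite (lam ` I)" using I by simp
  then have "lam ` I \<in> sets borel" by (simp add: sets.countable countable_finite)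
  then have B: "- (lam ` I) \<in> sets borel" by (rule borel_comp)
  have "emeasure \<mu> (- (lam ` I)) = 0"
    unfolding emeasure[OF B] using B by (intro sum.neutral) auto
  then have "- (lam ` I) \<in> null_sets \<mu>" using B sets by auto
  then have AE: "AE x in \<mu>. x \<in> lam ` I"
    by (rule AE_I'[of "- (lam ` I)"]) auto
  have pt: "measure \<mu> {lam i} = a i" if "i \<in> I" for i
  proof -
    have "emeasure \<mu> {lam i} = (\<Sum>j\<in>I. ennreal (a j) * emeasure (return borel (lam j)) {lam i})"
      by (rule emeasure) simp
    also have "\<dots> = (\<Sum>j\<in>I. if j = i then ennreal (a i) else 0)"
      using I that by (intro sum.cong) (auto simp: inj_on_def indicator_def)
    finally show ?thesis using I that a by (simp add: measure_def)
  qed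
  have "(LINT t|\<mu>. f t) = (LINT t|\<mu>. (\<Sum>i\<in>I. f (lam i) * indicator {lam i} t))"
  proof (rule integral_cong_AE)
    show "AE t in \<mu>. f t = (\<Sum>i\<in>I. f (lam i) * indicator {lam i} t)"
      using AE
    proof (rule AE_mp, intro AE_I2 impI)
      fix t assume "t \<in> lam ` I"
      then obtain j where j: "j \<in> I" "t = lam j" by auto
      have "(\<Sum>i\<in>I. f (lam i) * indicator {lam i} t) = (\<Sum>i\<in>I. if i = j then f (lam j) else 0)"
        using I j by (intro sum.cong) (auto simp: inj_on_def indicator_def)
      then show "f t = (\<Sum>i\<in>I. f (lam i) * indicator {lam i} t)" using I j by simp
    qed
  qed measurable
  also have "\<dots> = (\<Sum>i\<in>I. LINT t|\<mu>. f (lam i) * indicator {lam i} t)"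
    by (intro Bochner_Integration.integral_sum integrable_mult_right integrable_real_indicator)
      (auto simp: sets less_top[symmetric] emeasure_finite)
  also have "\<dots> = (\<Sum>i\<in>I. a i * f (lam i))"
    by (intro sum.cong refl) (simp add: pt mult.commute sets)
  finally show ?thesis .
qed

text \<open>The fourth power of \<open>v n\<close> is the ratio of moments two steps apart, so the
  product telescopes to two consecutive moments at either end.\<close>

lemma aluthge_power_moments:
  fixes \<gamma> :: "nat \<Rightarrow> real"
  assumes "\<And>n. 0 < \<gamma> n"
  defines "v \<equiv> \<lambda>n. sqrt (sqrt (\<gamma> (Suc n) / \<gamma> n) * sqrt (\<gamma> (Suc (Suc n)) / \<gamma> (Suc n)))"
  shows "(\<Prod>i<n. (v i)\<^sup>2)\<^sup>2 = \<gamma> n * \<gamma> (Suc n) / (\<gamma> 0 * \<gamma> 1)"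
proof (induction n)
  case (Suc n)
  have "((v n)\<^sup>2)\<^sup>2 = \<gamma> (Suc (Suc n)) / \<gamma> n"
    using assms(1)[of n] assms(1)[of "Suc n"] assms(1)[of "Suc (Suc n)"]
    by (simp add: v_def power_mult_distrib less_imp_le)
  then show ?case
    using assms(1)[of n] Suc by (simp add: power_mult_distrib field_simps)
qed (use assms(1)[of 0] assms(1)[of 1] in simp)

lemma power_sums_mult:
  fixes a c lam :: "'i \<Rightarrow> real"
  assumes "finite I"
  shows "(\<Sum>i\<in>I. a i * lam i ^ n) * (\<Sum>i\<in>I. c i * lam i ^ n)
    = (\<Sum>e\<in>(\<lambda>(i, j). lam i * lam j) ` (I \<times> I).
        (\<Sum>(i, j)\<in>{z \<in> I \<times> I. (\<lambda>(i, j). lam i * lam j) z = e}. a i * c j) * e ^ n)"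
proof -
  let ?f = "\<lambda>(i, j). lam i * lam j"
  have "(\<Sum>i\<in>I. a i * lam i ^ n) * (\<Sum>i\<in>I. c i * lam i ^ n)
    = (\<Sum>z\<in>I \<times> I. (case z of (i, j) \<Rightarrow> a i * c j) * ?f z ^ n)"
    unfolding sum_product sum.cartesian_product
    by (intro sum.cong refl) (auto simp: power_mult_distrib)
  also have "\<dots> = (\<Sum>e\<in>?f ` (I \<times> I). \<Sum>z\<in>{z \<in> I \<times> I. ?f z = e}. (case z of (i, j) \<Rightarrow> a i * c j) * ?f z ^ n)"
    by (rule sum.group[symmetric]) (use assms in auto)
  also have "\<dots> = (\<Sum>e\<in>?f ` (I \<times> I). (\<Sum>z\<in>{z \<in> I \<times> I. ?f z = e}. (case z of (i, j) \<Rightarrow> a i * c j)) * e ^ n)"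
    by (intro sum.cong refl) (simp add: sum_distrib_right)
  finally show ?thesis .
qed

text \<open>Dividing by \<open>s\<close> moves the base \<open>s\<close> to exponent 0; coefficients
  with equal logarithms are merged.\<close>

lemma exp_ln_sum:
  fixes a lam :: "'i \<Rightarrow> real"
  assumes "finite I" "\<And>i. i \<in> I \<Longrightarrow> 0 < lam i" "0 < s"
  shows "(\<Sum>x\<in>(\<lambda>i. ln (lam i / s)) ` I. (\<Sum>i\<in>{i \<in> I. ln (lam i / s) = x}. a i) * exp x ^ n)
    = (\<Sum>i\<in>I. a i * lam i ^ n) / s ^ n"
proof -
  have "(\<Sum>i\<in>I. a i * lam i ^ n) / s ^ n = (\<Sum>i\<in>I. a i * exp (ln (lam i / s)) ^ n)"
    unfolding sum_divide_distrib using assms by (intro sum.cong refl) (simp add: power_divide)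
  also have "\<dots> = (\<Sum>x\<in>(\<lambda>i. ln (lam i / s)) ` I. \<Sum>i\<in>{i \<in> I. ln (lam i / s)
    = x}. a i * exp (ln (lam i / s)) ^ n)"
    by (rule sum.group[symmetric]) (use assms in auto)
  also have "\<dots> = (\<Sum>x\<in>(\<lambda>i. ln (lam i / s)) ` I. (\<Sum>i\<in>{i \<in> I. ln (lam i / s) = x}. a i) * exp x ^ n)"
    by (intro sum.cong refl) (simp add: sum_distrib_right)
  finally show ?thesis by simp
qed

theorem proposition4p5:
  fixes \<mu> :: "real measure" and a lam :: "nat \<Rightarrow> real"
  assumes "prob_space \<mu>" and "sets \<mu> = sets borel"
    and "\<And>A. A \<in> sets borel \<Longrightarrow>
           emeasure \<mu> A = (\<Sum>i=1..6. ennreal (a i) * emeasure (return borel (lam i)) A)"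
    and "\<And>i. i \<in> {1..6} \<Longrightarrow> 0 < a i"
    and "0 < lam 1" and "strict_mono_on {1..6} lam"
    and "(lam 2)\<^sup>2 = lam 1 * lam 3" and "(lam 5)\<^sup>2 = lam 4 * lam 6"
  shows "\<not> subnormal_on TYPE('k::chilbert_space) (aluthge (berger_shift \<mu>))"
proof
  let ?I = "{1..6} :: nat set"
  let ?\<gamma> = "moment \<mu>"
  note a = assms(4)
  have less: "lam i < lam j" if "i \<in> ?I" "j \<in> ?I" "i < j" for i j
    using assms(6) that by (simp add: strict_mono_on_def)
  have between: "lam 1 \<le> lam i" "lam i \<le> lam 6" if "i \<in> ?I" for i
    using less[of 1 i] less[of i 6] that by (cases "i = 1"; cases "i = 6"; force)+
  have lam: "0 < lam i" if "i \<in> ?I" for i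
    using between(1)[OF that] assms(5) by linarith
  have \<gamma>: "?\<gamma> n = (\<Sum>i\<in>?I. a i * lam i ^ n)" for n
    unfolding moment_def
  proof (rule integral_point_masses[OF _ assms(2,3)])
    show "finite_measure \<mu>" using assms(1) by (rule prob_space.finite_measure)
    show "inj_on lam ?I" using assms(6) by (rule strict_mono_on_imp_inj_on)
  qed (use a less_imp_le in auto)
  have \<gamma>_pos: "0 < ?\<gamma> n" for n
    unfolding \<gamma> by (rule sum_pos) (use a lam in auto)
  have ratio: "lam 1 \<le> ?\<gamma> (Suc n) / ?\<gamma> n" "?\<gamma> (Suc n) / ?\<gamma> n \<le> lam 6" for n
  proof -
    have "a i * (lam 1 * lam i ^ n) \<le> a i * lam i ^ Suc n"
      "a i * lam i ^ Suc n \<le> a i * (lam 6 * lam i ^ n)"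
      if "i \<in> ?I" for i
      using a[OF that] between[OF that] lam[OF that] by (simp_all add: mult_right_mono)
    then have "lam 1 * ?\<gamma> n \<le> ?\<gamma> (Suc n)" "?\<gamma> (Suc n) \<le> lam 6 * ?\<gamma> n"
      unfolding \<gamma> sum_distrib_left by (auto intro!: sum_mono simp: mult.left_commute)
    then show "lam 1 \<le> ?\<gamma> (Suc n) / ?\<gamma> n" "?\<gamma> (Suc n) / ?\<gamma> n \<le> lam 6"
      using \<gamma>_pos[of n] by (simp_all add: field_simps)
  qed
  define w where "w = shift_weight \<mu>"
  have w: "sqrt (lam 1) \<le> w n" "w n \<le> sqrt (lam 6)" for n
    using ratio[of n] by (simp_all add: w_def shift_weight_def)
  have w_pos: "0 < w n" for n using w(1)[of n] assms(5) by (metis less_le_trans real_sqrt_gt_zero)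
  define v where "v n = sqrt (w n * w (Suc n))" for n
  have v: "\<bar>v n\<bar> \<le> sqrt (lam 6)" for n
  proof -
    have "w n * w (Suc n) \<le> (sqrt (lam 6))\<^sup>2"
      unfolding power2_eq_square using w(2) w_pos[of n] w_pos[of "Suc n"]
        by (intro mult_mono) (auto simp: less_imp_le lam)
    then show ?thesis
      using w_pos[of n] w_pos[of "Suc n"] lam[of 6] by (simp add: v_def)
  qed
  assume "subnormal_on TYPE('k) (aluthge (berger_shift \<mu>))"
  then have "subnormal_on TYPE('k) (weighted_shift v)"
    using aluthge_weighted_shift[of "sqrt (lam 1)" w "sqrt (lam 6)"] w assms(5)
    by (simp add: berger_shift_def w_def v_def[abs_def])
  then obtain u :: "nat \<Rightarrow> 'k" where u: "inner (u k) (u l) = (\<Prod>i<k + l. (v i)\<^sup>2)" for k l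
    using subnormal_weighted_shift_gram[of v, OF v] by blast
  define \<beta> where "\<beta> n = (\<Prod>i<n. (v i)\<^sup>2)" for n
  interpret hankel_gram u \<beta> by unfold_locales (simp add: u \<beta>_def)
  have \<beta>_pos: "0 < \<beta> n" for n
    unfolding \<beta>_def v_def using w_pos by (intro prod_pos zero_less_power ballI) simp
  have \<beta>: "(\<beta> n)\<^sup>2 = ?\<gamma> n * ?\<gamma> (Suc n) / (?\<gamma> 0 * ?\<gamma> 1)" for n
    unfolding \<beta>_def v_def w_def shift_weight_def using aluthge_power_moments[OF \<gamma>_pos] by simp
  let ?f = "\<lambda>(i, j). lam i * lam j"
  let ?S = "?f ` (?I \<times> ?I)"
  obtain d where d: "(\<beta> n)\<^sup>2 = (\<Sum>e\<in>?S. d e * e ^ n)" for n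
  proof
    fix n
    have "(\<Sum>i\<in>?I. (a i * lam i / (?\<gamma> 0 * ?\<gamma> 1)) * lam i ^ n) = ?\<gamma> (Suc n) / (?\<gamma> 0 * ?\<gamma> 1)"
      unfolding \<gamma>[of "Suc n"] sum_divide_distrib by (intro sum.cong refl) simp
    then have "(\<beta> n)\<^sup>2 = (\<Sum>i\<in>?I. a i * lam i ^ n) * (\<Sum>i\<in>?I. (a i * lam i / (?\<gamma> 0 * ?\<gamma> 1)) * lam i ^ n)"
      unfolding \<beta> \<gamma>[of n, symmetric] by simp
    then show "(\<beta> n)\<^sup>2 = (\<Sum>e\<in>?S. (\<Sum>(i, j)\<in>{z \<in> ?I \<times> ?I. ?f z
      = e}. a i * (a j * lam j / (?\<gamma> 0 * ?\<gamma> 1))) * e ^ n)"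
      by (subst power_sums_mult[symmetric]) simp_all
  qed
  have "\<beta> n \<noteq> 0" for n using \<beta>_pos[of n] by simp
  then have "\<exists>R h. finite R \<and> (\<forall>x\<in>R. 0 < h x) \<and> (\<forall>n. \<beta> n = (\<Sum>x\<in>R. h x * x ^ n))"
    by (intro finitely_atomic_if_square[OF _ d]) simp_all
  then obtain R h where R: "finite R" and h: "\<And>x. x \<in> R \<Longrightarrow> 0 < h x"
    and \<beta>_R: "\<And>n. \<beta> n = (\<Sum>x\<in>R. h x * x ^ n)"
    by blast
  \<comment> \<open>So far the atoms in \<open>R\<close> are arbitrary reals, but logarithms need
    positive ones. Their pairwise products are products of atoms of the measure, so all have the
    same sign and none is 0; \<open>\<beta> 1 > 0\<close> then excludes negative ones.\<close>
  have prod_pos: "0 < x * y" if "x \<in> R" "y \<in> R" for x y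
  proof -
    have "(\<lambda>(x, y). x * y) (x, y) \<in> ?S"
    proof (rule bases_of_positive_power_sum[where Z = "R \<times> R" and c = "\<lambda>(x, y). h x * h y" and d = d])
      fix n
      show "(\<Sum>z\<in>R \<times> R. (case z of (x, y) \<Rightarrow> h x * h y) * (case z of (x, y) \<Rightarrow> x * y) ^ n)
        = (\<Sum>e\<in>?S. d e * e ^ n)"
        unfolding d[symmetric] \<beta>_R power2_eq_square sum_product sum.cartesian_product
        by (intro sum.cong refl) (auto simp: power_mult_distrib)
    qed (use R h that in auto)
    then show ?thesis using lam by auto
  qed
  have R_pos: "0 < x" if x: "x \<in> R" for x
  proof (rule ccontr)
    assume "\<not> 0 < x"
    then have "x < 0" using prod_pos[OF x x] by (cases "x = 0") auto
    then have "y < 0" if "y \<in> R" for y using prod_pos[OF x that] by (simp add: zero_less_mult_iff)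
    then have "\<beta> 1 \<le> 0" unfolding \<beta>_R using h
      by (intro sum_nonpos) (auto simp: mult_nonneg_nonpos less_imp_le)
    then show False using \<beta>_pos[of 1] by simp
  qed
  let ?l = "\<lambda>i. ln (lam i / lam 1)" and ?r = "\<lambda>x. ln (x / lam 1)"
  define p q M where "p = ?l 2" and "q = ?l 6 - ?l 5" and "M = ?l 6"
  have l: "?l i = ln (lam i) - ln (lam 1)" if "i \<in> ?I" for i
    using lam[OF that] assms(5) by (simp add: ln_div)
  have ln_sq: "2 * ln (lam j) = ln (lam i) + ln (lam k)"
    if "(lam j)\<^sup>2 = lam i * lam k" "i \<in> ?I" "j \<in> ?I" "k \<in> ?I" for i j k
    using arg_cong[OF that(1), of ln] lam[OF that(2)] lam[OF that(3)] lam[OF that(4)]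
    by (simp add: ln_mult ln_realpow)
  have "2 * ln (lam 2) = ln (lam 1) + ln (lam 3)" "2 * ln (lam 5) = ln (lam 4) + ln (lam 6)"
    by (rule ln_sq[OF assms(7)]; simp) (rule ln_sq[OF assms(8)]; simp)
  then have l_eq: "?l 1 = 0" "?l 2 = p" "?l 3 = 2 * p" "?l 4 = M - 2 * q" "?l 5 = M - q" "?l 6 = M"
    using l by (simp_all add: p_def q_def M_def)
  have X: "{0, p, 2 * p, M - 2 * q, M - q, M} = ?l ` ?I"
  proof -
    have "?I = {1, 2, 3, 4, 5, 6}" by auto
    then show ?thesis by (simp only: image_insert image_empty l_eq)
  qed
  have l_less: "?l i < ?l j" if "i \<in> ?I" "j \<in> ?I" "i < j" for i j
    using less[OF that] lam that l by simp
  define A where "A x = (\<Sum>i\<in>{i \<in> ?I. ?l i = x}. a i)" for x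
  \<comment> \<open>This factor absorbs both the normalisation of \<open>\<beta>\<close> and the
    extra power of \<open>lam 1\<close> left by rescaling two consecutive moments.\<close>
  define \<kappa> where "\<kappa> = sqrt (?\<gamma> 0 * ?\<gamma> 1 / lam 1)"
  define H where "H y = \<kappa> * (\<Sum>x\<in>{x \<in> R. ?r x = y}. h x)" for y
  have \<kappa>: "0 < \<kappa>" using \<gamma>_pos assms(5) by (simp add: \<kappa>_def)
  show False
  proof (rule no_exponential_square[of p q M A "?r ` R" H])
    show "0 < p" "0 < q" "2 * p + 2 * q < M"
      using l_less[of 1 2] l_less[of 5 6] l_less[of 3 4] l_eq by simp_all
    show "0 < A x" if "x \<in> {0, p, 2 * p, M - 2 * q, M - q, M}" for x
      using that a unfolding X A_def by (intro sum_pos) auto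
    show "A x = 0" if "x \<notin> {0, p, 2 * p, M - 2 * q, M - q, M}" for x
      using that unfolding X A_def by (intro sum.neutral) auto
    show "finite (?r ` R)" using R by simp
    show "0 < H x" if "x \<in> ?r ` R" for x
      using that h R \<kappa> unfolding H_def by (intro mult_pos_pos sum_pos) auto
    show "H x = 0" if "x \<notin> ?r ` R" for x
    proof -
      have "{y \<in> R. ?r y = x} = {}" using that by auto
      then show ?thesis by (simp only: H_def sum.empty mult_zero_right)
    qed
    fix n
    have A: "(\<Sum>x\<in>?l ` ?I. A x * exp x ^ n) = ?\<gamma> n / lam 1 ^ n" for n
      unfolding A_def \<gamma> using lam assms(5) by (intro exp_ln_sum) auto
    have "(\<Sum>x\<in>?r ` R. (\<Sum>y\<in>{y \<in> R. ?r y = x}. h y) * exp x ^ n) = \<beta> n / lam 1 ^ n"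
      unfolding \<beta>_R using R R_pos assms(5) by (intro exp_ln_sum) auto
    then have "(\<Sum>x\<in>?r ` R. H x * exp x ^ n) = \<kappa> * (\<beta> n / lam 1 ^ n)"
      unfolding H_def mult.assoc sum_distrib_left[symmetric] by simp
    moreover have "(\<kappa> * (\<beta> n / lam 1 ^ n))\<^sup>2 = (?\<gamma> n / lam 1 ^ n) * (?\<gamma> (Suc n) / lam 1 ^ Suc n)"
      using \<gamma>_pos[of 0] \<gamma>_pos[of 1] assms(5)
      by (simp add: power_mult_distrib power_divide \<beta> \<kappa>_def less_imp_le)
        (simp add: field_simps power2_eq_square)
    ultimately show "(\<Sum>x\<in>{0, p, 2 * p, M - 2 * q, M - q, M}. A x * exp x ^ n)
        * (\<Sum>x\<in>{0, p, 2 * p, M - 2 * q, M - q, M}. A x * exp x ^ Suc n) = (\<Sum>x\<in>?r ` R. H x * exp x ^ n)\<^sup>2"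
      unfolding X A by simp
  qed
qed

end
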